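(* Let $\ell\geq 0$ and $d\geq 2$. If $\Delta$ is a $(d-1)$-dimensional flag homology sphere (over a field $\mathbb{K}$) with $2d+\ell$ vertices, then $0\leq\gamma_\ell\leq 1$ and $\gamma_j=0$ for all $j>\ell$. Furthermore, $\gamma_\ell=1$ if and only if $\Delta\cong\Sigma^m*^{\ell}C_5$ for some $m\geq 0$.
   Context: A simplicial complex is a finite family of subsets (faces) of a finite vertex set, closed under subsets, with every vertex a face; pure of dimension $d-1$ if all maximal faces have $d$ elements. Link: $\mathrm{lk}_\Delta(f)=\{g\in\Delta:g\cap f=\emptyset,\ g\cup f\in\Delta\}$. A $(d-1)$-dimensional homology sphere over $\mathbb{K}$ is a pure $(d-1)$-dimensional complex such that for every face $f$ (including $\emptyset$), $\tilde H_i(\mathrm{lk}_\Delta(f);\mathbb{K})$ is $0$ for $i<d-1-|f|$ and $\mathbb{K}$ for $i=d-1-|f|$. Flag: every minimal non-face has two elements. With $f_i$ the number of faces of cardinality $i$ ($f_0=1$) and $h(z)=\sum_{i=0}^d f_i(z-1)^{d-i}$, write uniquely $h(z)=\sum_{i=0}^{\lfloor d/2\rfloor}\gamma_iz^i(1+z)^{d-2i}$ (so $\gamma_0=1$, $\gamma_1=f_1-2d$), and $\gamma_j:=0$ for $j>\lfloor d/2\rfloor$. Join: $\Delta_1*\Delta_2=\{f_1\sqcup f_2:f_i\in\Delta_i\}$ (disjoint vertex sets); $*^{j}X$ is the $j$-fold join of copies of $X$, with $*^0X=\{\emptyset\}$. Suspension $\Sigma\Delta=S^0*\Delta$ ($S^0$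 two isolated vertices), $\Sigma^m$ its $m$-fold iterate. $C_5$ is the $5$-cycle graph as a $1$-dimensional complex. *)

theory Defs
  imports
    "HOL-Computational_Algebra.Polynomial"
    "HOL-Library.Nat_Bijection"
begin

section \<open>Simplicial complexes\<close>

text \<open>
  A complex is given by its set of faces. The vertex set is the union of the faces, so every
  vertex is a face by closure under subsets. The empty face always belongs to a complex.
\<close>

definition simplicial_complex :: "'a set set \<Rightarrow> bool" where
  "simplicial_complex \<Delta> \<longleftrightarrow>
     finite \<Delta> \<and> (\<forall>f\<in>\<Delta>. finite f) \<and> {} \<in> \<Delta> \<and> (\<forall>f\<in>\<Delta>. \<forall>g. g \<subseteq> f \<longrightarrow> g \<in> \<Delta>)"

definition simplicial_vertices :: "'a set set \<Rightarrow> 'a set" where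
  "simplicial_vertices \<Delta> = \<Union>\<Delta>"

text \<open>Purity of dimension \<open>d - 1\<close>.\<close>

definition pure_complex :: "nat \<Rightarrow> 'a set set \<Rightarrow> bool" where
  "pure_complex d \<Delta> \<longleftrightarrow> (\<forall>f\<in>\<Delta>. (\<forall>g\<in>\<Delta>. f \<subseteq> g \<longrightarrow> g = f) \<longrightarrow> card f = d)"

definition simplicial_link :: "'a set set \<Rightarrow> 'a set \<Rightarrow> 'a set set" where
  "simplicial_link \<Delta> f = {g \<in> \<Delta>. g \<inter> f = {} \<and> g \<union> f \<in> \<Delta>}"

definition minimal_nonface :: "'a set set \<Rightarrow> 'a set \<Rightarrow> bool" where
  "minimal_nonface \<Delta> s \<longleftrightarrow>
     s \<subseteq> simplicial_vertices \<Delta> \<and> s \<notin> \<Delta> \<and> (\<forall>t. t \<subset> s \<longrightarrow> t \<in> \<Delta>)"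

definition flag_complex :: "'a set set \<Rightarrow> bool" where
  "flag_complex \<Delta> \<longleftrightarrow> (\<forall>s. minimal_nonface \<Delta> s \<longrightarrow> card s = 2)"

definition simplicial_isomorphic :: "'a set set \<Rightarrow> 'b set set \<Rightarrow> bool" where
  "simplicial_isomorphic \<Delta> \<Gamma> \<longleftrightarrow>
     (\<exists>\<phi>. bij_betw \<phi> (simplicial_vertices \<Delta>) (simplicial_vertices \<Gamma>) \<and> (\<lambda>f. \<phi> ` f) ` \<Delta> = \<Gamma>)"


section \<open>Reduced simplicial homology over a field\<close>

text \<open>
  Faces are oriented by one arbitrary linear order on the vertex type; up to isomorphism,
  homology does not depend on it.
\<close>

definition vertex_order :: "('a \<times> 'a) set" where
  "vertex_order = (SOME r. linear_order r)"

lemma linear_order_vertex_order: "linear_order (vertex_order :: ('a \<times> 'a) set)"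
proof -
  obtain r :: "('a \<times> 'a) set" where r: "Well_order r" "Field r = UNIV"
    using well_ordering[where ?'a = 'a] by (elim exE conjE)
  have "linear_order r"
    using r(1) unfolding r(2) well_order_on_def by (rule conjunct1)
  then show ?thesis
    unfolding vertex_order_def by (rule someI)
qed

text \<open>
  Chains are indexed by dimension \<open>i\<close>, an integer, so that the augmentation of the reduced
  complex is the boundary from dimension \<open>0\<close> to dimension \<open>- 1\<close>, which is spanned by the
  empty face. A chain is the function assigning to each face its coefficient.
\<close>

definition simplicial_chains :: "'a set set \<Rightarrow> int \<Rightarrow> ('a set \<Rightarrow> 'k::field) set" where
  "simplicial_chains \<Delta> i = {c. \<forall>f. c f \<noteq> 0 \<longrightarrow> f \<in> \<Delta> \<and> int (card f) = i + 1}"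

text \<open>
  The usual boundary \<open>\<partial>[v\<^sub>0, \<dots>, v\<^sub>i] = (\<Sum>j\<le>i. (-1)^j [v\<^sub>0, \<dots>, v\<^sub>j\<^sub>-\<^sub>1, v\<^sub>j\<^sub>+\<^sub>1, \<dots>, v\<^sub>i])\<close>, read off
  coefficientwise: the face \<open>g\<close> receives a contribution from each \<open>insert v g\<close>, with sign given
  by the position of \<open>v\<close> in it.
\<close>

definition simplicial_boundary :: "'a set set \<Rightarrow> ('a set \<Rightarrow> 'k::field) \<Rightarrow> 'a set \<Rightarrow> 'k" where
  "simplicial_boundary \<Delta> c g =
     (\<Sum>v \<in> simplicial_vertices \<Delta> - g.
        (- 1) ^ card {u \<in> g. (u, v) \<in> vertex_order} * c (insert v g))"

definition simplicial_cycles :: "'a set set \<Rightarrow> int \<Rightarrow> ('a set \<Rightarrow> 'k::field) set" where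
  "simplicial_cycles \<Delta> i = {c \<in> simplicial_chains \<Delta> i. simplicial_boundary \<Delta> c = (\<lambda>_. 0)}"

definition simplicial_boundaries :: "'a set set \<Rightarrow> int \<Rightarrow> ('a set \<Rightarrow> 'k::field) set" where
  "simplicial_boundaries \<Delta> i = simplicial_boundary \<Delta> ` simplicial_chains \<Delta> (i + 1)"

definition homology_coset ::
    "'a set set \<Rightarrow> int \<Rightarrow> ('a set \<Rightarrow> 'k::field) \<Rightarrow> ('a set \<Rightarrow> 'k) set" where
  "homology_coset \<Delta> i z = {w. (\<lambda>f. w f - z f) \<in> simplicial_boundaries \<Delta> i}"

definition reduced_homology :: "'a set set \<Rightarrow> int \<Rightarrow> ('a set \<Rightarrow> 'k::field) set set" where
  "reduced_homology \<Delta> i = homology_coset \<Delta> i ` simplicial_cycles \<Delta> i"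

text \<open>The type argument selects the coefficient field.\<close>

definition reduced_homology_zero :: "'k::field itself \<Rightarrow> 'a set set \<Rightarrow> int \<Rightarrow> bool" where
  "reduced_homology_zero _ \<Delta> i \<longleftrightarrow>
     (reduced_homology \<Delta> i :: ('a set \<Rightarrow> 'k) set set) = {homology_coset \<Delta> i (\<lambda>_. 0)}"

text \<open>Existence of a \<open>'k\<close>-linear isomorphism from the homology to \<open>'k\<close>.\<close>

definition reduced_homology_field :: "'k::field itself \<Rightarrow> 'a set set \<Rightarrow> int \<Rightarrow> bool" where
  "reduced_homology_field _ \<Delta> i \<longleftrightarrow>
     (\<exists>\<phi> :: ('a set \<Rightarrow> 'k) set \<Rightarrow> 'k.
        bij_betw \<phi> (reduced_homology \<Delta> i) UNIV \<and>
        (\<forall>y\<in>simplicial_cycles \<Delta> i. \<forall>z\<in>simplicial_cycles \<Delta> i.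
           \<phi> (homology_coset \<Delta> i (\<lambda>f. y f + z f)) =
             \<phi> (homology_coset \<Delta> i y) + \<phi> (homology_coset \<Delta> i z)) \<and>
        (\<forall>a. \<forall>z\<in>simplicial_cycles \<Delta> i.
           \<phi> (homology_coset \<Delta> i (\<lambda>f. a * z f)) = a * \<phi> (homology_coset \<Delta> i z)))"

text \<open>Homology spheres of dimension \<open>d - 1\<close>.\<close>

definition homology_sphere :: "'k::field itself \<Rightarrow> nat \<Rightarrow> 'a set set \<Rightarrow> bool" where
  "homology_sphere K d \<Delta> \<longleftrightarrow>
     simplicial_complex \<Delta> \<and> pure_complex d \<Delta> \<and>
     (\<forall>f\<in>\<Delta>.
        (\<forall>i < int d - 1 - int (card f). reduced_homology_zero K (simplicial_link \<Delta> f) i) \<and>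
        reduced_homology_field K (simplicial_link \<Delta> f) (int d - 1 - int (card f)))"


section \<open>Face numbers and the gamma vector\<close>

definition face_number :: "'a set set \<Rightarrow> nat \<Rightarrow> nat" where
  "face_number \<Delta> i = card {f \<in> \<Delta>. card f = i}"

definition h_polynomial :: "nat \<Rightarrow> 'a set set \<Rightarrow> int poly" where
  "h_polynomial d \<Delta> = (\<Sum>i\<le>d. of_nat (face_number \<Delta> i) * [:- 1, 1:] ^ (d - i))"

text \<open>
  The coefficients of the expansion are unique, and they exist exactly when the h-polynomial
  satisfies the Dehn-Sommerville relations, as it does for homology spheres. They are integers
  because the system determining them is unitriangular.
\<close>

definition gamma_vector :: "nat \<Rightarrow> 'a set set \<Rightarrow> nat \<Rightarrow> int" where
  "gamma_vector d \<Delta> =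
     (THE \<gamma>. h_polynomial d \<Delta> =
               (\<Sum>i\<le>d div 2. of_int (\<gamma> i) * [:0, 1:] ^ i * [:1, 1:] ^ (d - 2 * i)) \<and>
             (\<forall>j > d div 2. \<gamma> j = 0))"


section \<open>Joins, suspensions and the pentagon\<close>

text \<open>
  The models below have natural number vertices. Encoding the disjoint union of two vertex sets
  back into \<open>nat\<close> keeps the type fixed, so that joins and suspensions can be iterated.
\<close>

definition simplicial_join :: "nat set set \<Rightarrow> nat set set \<Rightarrow> nat set set" where
  "simplicial_join \<Delta> \<Gamma> = {sum_encode ` (f <+> g) | f g. f \<in> \<Delta> \<and> g \<in> \<Gamma>}"

primrec join_power :: "nat \<Rightarrow> nat set set \<Rightarrow> nat set set" where
  "join_power 0 X = {{}}"
| "join_power (Suc j) X = simplicial_join X (join_power j X)"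

definition sphere0_complex :: "nat set set" where
  "sphere0_complex = {{}, {0}, {1}}"

definition simplicial_suspension :: "nat set set \<Rightarrow> nat set set" where
  "simplicial_suspension \<Delta> = simplicial_join sphere0_complex \<Delta>"

definition pentagon_complex :: "nat set set" where
  "pentagon_complex =
     {{}, {0}, {1}, {2}, {3}, {4}, {0, 1}, {1, 2}, {2, 3}, {3, 4}, {4, 0}}"

end

theory Submission
  imports Defs "HOL-Library.Function_Algebras"
begin

text \<open>
  Of the homology condition only the Euler characteristics of the links are used. Summing the
  \<open>h\<close>-polynomials of the vertex links gives \<open>d h + (1 - z) h'\<close>, which yields the Dehn-Sommerville
  relations and the recurrence
  \<open>(\<Sum>v. \<gamma>\<^sub>j (lk v)) = (j + 1) \<gamma>\<^sub>j\<^sub>+\<^sub>1 + (2d - 4j) \<gamma>\<^sub>j\<close>.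
  No vertex is adjacent to all others, so a vertex link has at most \<open>2(d - 1) + l\<close> vertices, with
  equality only if the complex is a suspension over the link. Otherwise \<open>\<gamma>\<^sub>j\<close> vanishes for \<open>j \<ge> l\<close> in
  all vertex links by induction on \<open>d\<close>, and the recurrence, run downwards, gives the same for the
  complex, provided that \<open>\<gamma>\<close> vanishes in degree \<open>d / 2\<close> when \<open>d\<close> is even. That coefficient is
  \<open>\<plusminus>h(-1)\<close>; inclusion-exclusion over the faces \<open>F\<close> contained in the set \<open>U\<close> of non-neighbours of a
  vertex of maximal degree expresses it by the top coefficients of the links of the even faces
  \<open>F \<noteq> {}\<close>. These links have too few vertices for a nonzero coefficient, unless \<open>U\<close> is an edge
  \<open>{a, b}\<close>, \<open>l = d / 2\<close> and the link of this edge is itself extremal; then the complex is the join of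
  that link with a pentagon.
\<close>

section \<open>Euler characteristic and homology\<close>

text \<open>The excess of the vertex number over \<open>2d\<close> governs the result. It is
  additive under joins, \<open>0\<close> for two points and \<open>1\<close> for the pentagon, while
  gamma polynomials multiply, with factors \<open>1\<close> and \<open>1 + t\<close>; so
  \<open>l\<close> pentagons give binomial coefficients and last value \<open>1\<close>. Passing to
  the link of a vertex with \<open>k\<close> non-neighbours lowers the excess by
  \<open>k - 1\<close>, which is why one non-neighbour is the special case. The obstacle is degree
  \<open>d / 2\<close>: there the factor \<open>2d - 4j\<close> vanishes, and the gamma vectors of
  vertex links stop below that degree, so links of even faces must take over. Evaluation at
  \<open>z = -1\<close> isolates this coefficient. Since \<open>h\<close> is written in powers of
  \<open>z - 1\<close>, a face then counts with a power of \<open>-2\<close>, whence the weights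
  \<open>-1/2\<close>. Maximal degree of \<open>v\<close> matters because the faces \<open>F\<close>
  consist of other vertices: it bounds the links of those vertices by the link of \<open>v\<close>,
  so that a large \<open>U\<close> forces a small excess on all links of such faces at once.\<close>

lemma simplicial_complexD:
  assumes "simplicial_complex \<Delta>"
  shows "finite \<Delta>" "f \<in> \<Delta> \<Longrightarrow> finite f" "{} \<in> \<Delta>" "f \<in> \<Delta> \<Longrightarrow> g \<subseteq> f \<Longrightarrow> g \<in> \<Delta>"
  using assms by (auto simp: simplicial_complex_def)

section \<open>Linear algebra in spaces of functions\<close>

lemma (in vector_space) independent_disjoint_spans:
  assumes "independent (B \<union> C)" "B \<inter> C = {}" "finite B" "finite C"
    and "x \<in> span B" "x \<in> span C"
  shows "x = 0"
proof -
  obtain a where a: "x = (\<Sum>v\<in>B. scale (a v) v)"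
    using assms(5) span_finite[OF assms(3)] by auto
  obtain b where b: "x = (\<Sum>v\<in>C. scale (b v) v)"
    using assms(6) span_finite[OF assms(4)] by auto
  define c where "c v = (if v \<in> B then a v else - b v)" for v
  have "(\<Sum>v\<in>B \<union> C. scale (c v) v) = (\<Sum>v\<in>B. scale (c v) v) + (\<Sum>v\<in>C. scale (c v) v)"
    using assms by (intro sum.union_disjoint)
  also have "(\<Sum>v\<in>B. scale (c v) v) = x"
    unfolding a by (intro sum.cong) (auto simp: c_def)
  also have "(\<Sum>v\<in>C. scale (c v) v) = (\<Sum>v\<in>C. - scale (b v) v)"
    using assms(2) by (intro sum.cong) (auto simp: c_def)
  also have "\<dots> = - x"
    unfolding b by (rule sum_negf)
  finally have "(\<Sum>v\<in>B \<union> C. scale (c v) v) = 0" by simp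
  then have "c v = 0" if "v \<in> B" for v
    using independentD[OF assms(1), of "B \<union> C" c v] assms that by auto
  then have "a v = 0" if "v \<in> B" for v
    using that by (auto simp: c_def)
  then show ?thesis
    unfolding a by simp
qed

text \<open>Relative to a subspace inside the span of a finite set, since chains live in the space
  of all functions on vertex sets, which may be infinite-dimensional. A basis \<open>A\<close> of
  the kernel extends to a basis \<open>B\<close> of \<open>S\<close>, and \<open>f\<close> is
  injective on the span of \<open>C = B - A\<close>.\<close>

lemma (in vector_space_pair) rank_nullity:
  assumes f: "Vector_Spaces.linear s1 s2 f" and S: "vs1.subspace S" and W: "S \<subseteq> vs1.span W" "finite W"
  shows "vs1.dim S = vs1.dim {x\<in>S. f x = 0} + vs2.dim (f ` S)"
proof -
  interpret f: Vector_Spaces.linear s1 s2 f by (fact f)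
  let ?K = "{x\<in>S. f x = 0}"
  obtain A where A: "A \<subseteq> ?K" "vs1.independent A" "?K \<subseteq> vs1.span A" "card A = vs1.dim ?K"
    using vs1.basis_exists[of ?K] by auto
  obtain B where B: "A \<subseteq> B" "B \<subseteq> S" "vs1.independent B" "S \<subseteq> vs1.span B"
    using vs1.maximal_independent_subset_extend[of A S] A by auto
  have fB: "finite B"
    using vs1.independent_span_bound[OF W(2) B(3)] B W by auto
  define C where "C = B - A"
  have BAC: "B = A \<union> C" "A \<inter> C = {}" and fin: "finite A" "finite C"
    using B fB finite_subset by (auto simp: C_def)
  have spanC: "vs1.span C \<subseteq> S"
    using S B by (intro vs1.span_minimal) (auto simp: C_def)
  have inj: "inj_on f (vs1.span C)"
  proof -
    have "x = 0" if "x \<in> vs1.span C" "f x = 0" for x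
      using vs1.independent_disjoint_spans[of A C x] BAC fin that A spanC B by auto
    then show ?thesis
      using f.inj_on_iff_eq_0[OF vs1.subspace_span] by blast
  qed
  have indep: "vs2.independent (f ` C)"
    using f.independent_inj_on_image[of C] inj B(3) vs1.independent_mono[of B C] C_def by auto
  have "f ` S \<subseteq> vs2.span (f ` B)"
    using B(4) f.span_image[of B] by auto
  also have "\<dots> \<subseteq> vs2.span (insert 0 (f ` C))"
    using A BAC by (intro vs2.span_mono) auto
  finally have "f ` S \<subseteq> vs2.span (f ` C)" by simp
  then have "vs2.dim (f ` S) = card (f ` C)"
    using indep B by (intro vs2.dim_unique[of "f ` C"]) (auto simp: C_def)
  also have "\<dots> = card C"
    using inj vs1.span_superset by (intro card_image) (auto intro: inj_on_subset)
  finally have "vs2.dim (f ` S) = card C" .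
  moreover have "vs1.dim S = card B"
    using B by (intro vs1.dim_unique) auto
  moreover have "card B = card A + card C"
    unfolding BAC(1) using BAC fin by (intro card_Un_disjoint)
  ultimately show ?thesis using A(4) by simp
qed

definition fscale :: "'k::field \<Rightarrow> ('s \<Rightarrow> 'k) \<Rightarrow> 's \<Rightarrow> 'k" where
  "fscale a c = (\<lambda>x. a * c x)"

interpretation fs: vector_space fscale
  by unfold_locales (auto simp: fscale_def fun_eq_iff algebra_simps)

interpretation fsp: vector_space_pair fscale fscale
  by unfold_locales

lemma sum_fun_apply: "(\<Sum>i\<in>I. f i) x = (\<Sum>i\<in>I. f i x :: 'b::comm_monoid_add)"
  by (induction I rule: infinite_finite_induct) auto

definition supported :: "'s set \<Rightarrow> ('s \<Rightarrow> 'k::field) set" where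
  "supported A = {c. \<forall>x. c x \<noteq> 0 \<longrightarrow> x \<in> A}"

lemma subspace_supported: "fs.subspace (supported A)"
  by (auto simp: fs.subspace_def supported_def fscale_def) (metis add.left_neutral)

lemma
  fixes A :: "'s set"
  assumes "finite A"
  shows dim_supported: "fs.dim (supported A :: ('s \<Rightarrow> 'k::field) set) = card A"
    and supported_finite_span:
      "\<exists>W. finite W \<and> (supported A :: ('s \<Rightarrow> 'k) set) \<subseteq> fs.span W"
proof -
  define e :: "'s \<Rightarrow> 's \<Rightarrow> 'k" where "e x = (\<lambda>y. if y = x then 1 else 0)" for x
  have inj: "inj_on e A"
    by (auto simp: inj_on_def e_def fun_eq_iff split: if_splits)
  have exp: "(\<Sum>x\<in>A. fscale (c x) (e x)) = c" if "c \<in> supported A" for c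
  proof
    fix y
    have "(\<Sum>x\<in>A. fscale (c x) (e x)) y = (\<Sum>x\<in>A. if y = x then c x else 0)"
      by (auto simp: sum_fun_apply fscale_def e_def intro!: sum.cong)
    also have "\<dots> = c y"
      using assms that by (auto simp: supported_def)
    finally show "(\<Sum>x\<in>A. fscale (c x) (e x)) y = c y" .
  qed
  have span: "(supported A :: ('s \<Rightarrow> 'k) set) \<subseteq> fs.span (e ` A)"
  proof
    fix c :: "'s \<Rightarrow> 'k" assume "c \<in> supported A"
    then have "c = (\<Sum>x\<in>A. fscale (c x) (e x))" by (simp add: exp)
    also have "\<dots> \<in> fs.span (e ` A)"
      by (intro fs.span_sum fs.span_scale fs.span_base) auto
    finally show "c \<in> fs.span (e ` A)" .
  qed
  have sub: "e ` A \<subseteq> supported A"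
    by (auto simp: supported_def e_def split: if_splits)
  have indep: "fs.independent (e ` A)"
  proof (rule fs.independent_if_scalars_zero)
    show "finite (e ` A)" using assms by simp
    fix f x
    assume 0: "(\<Sum>x\<in>e ` A. fscale (f x) x) = 0" and x: "x \<in> e ` A"
    then obtain y where y: "y \<in> A" "x = e y" by auto
    have "0 = (\<Sum>x\<in>A. fscale (f (e x)) (e x)) y"
      using 0 sum.reindex[OF inj, of "\<lambda>x. fscale (f x) x"] by simp
    also have "\<dots> = (\<Sum>x\<in>A. if y = x then f (e x) else 0)"
      by (auto simp: sum_fun_apply fscale_def e_def intro!: sum.cong)
    also have "\<dots> = f x" using assms y by simp
    finally show "f x = 0" by simp
  qed
  show "fs.dim (supported A :: ('s \<Rightarrow> 'k) set) = card A"
    using fs.dim_unique[OF sub span indep] card_image[OF inj] by simp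
  show "\<exists>W. finite W \<and> (supported A :: ('s \<Rightarrow> 'k) set) \<subseteq> fs.span W"
    using span assms by blast
qed

section \<open>The boundary operator\<close>

lemma linear_simplicial_boundary:
  "Vector_Spaces.linear fscale fscale (simplicial_boundary \<Gamma>)"
  by unfold_locales
    (auto simp: simplicial_boundary_def fscale_def fun_eq_iff sum.distrib[symmetric]
      sum_distrib_left algebra_simps)

lemma simplicial_chains_eq:
  "simplicial_chains \<Gamma> (int n - 1) = supported {f\<in>\<Gamma>. card f = n}"
  by (auto simp: simplicial_chains_def supported_def)

lemma simplicial_boundary_chain:
  assumes \<Gamma>: "simplicial_complex \<Gamma>" and c: "c \<in> supported {f\<in>\<Gamma>. card f = Suc n}"
  shows "simplicial_boundary \<Gamma> c \<in> supported {f\<in>\<Gamma>. card f = n}"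
proof -
  have "g \<in> \<Gamma> \<and> card g = n" if "simplicial_boundary \<Gamma> c g \<noteq> 0" for g
  proof -
    obtain v where v: "v \<notin> g" "c (insert v g) \<noteq> 0"
      using \<open>simplicial_boundary \<Gamma> c g \<noteq> 0\<close> unfolding simplicial_boundary_def
      by (metis (no_types, lifting) DiffD2 mult_zero_right sum.neutral)
    then have ins: "insert v g \<in> \<Gamma>" "card (insert v g) = Suc n"
      using c by (auto simp: supported_def)
    then have "finite g" "g \<in> \<Gamma>"
      using simplicial_complexD(2,4)[OF \<Gamma> ins(1)] by auto
    then show ?thesis using ins v by auto
  qed
  then show ?thesis by (auto simp: supported_def)
qed

lemma simplicial_boundary_0chain:
  assumes \<Gamma>: "simplicial_complex \<Gamma>" and c: "c \<in> supported {f\<in>\<Gamma>. card f = 0}"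
  shows "simplicial_boundary \<Gamma> c = 0"
proof
  fix g
  have "c (insert v g) = 0" for v
  proof (rule ccontr)
    assume "c (insert v g) \<noteq> 0"
    then have "insert v g \<in> \<Gamma>" "card (insert v g) = 0"
      using c by (auto simp: supported_def)
    \<comment> \<open>Cardinality \<open>0\<close> alone would not exclude an infinite set.\<close>
    moreover from this(1) have "finite (insert v g)"
      by (rule simplicial_complexD(2)[OF \<Gamma>])
    ultimately show False by simp
  qed
  then show "simplicial_boundary \<Gamma> c g = 0 g"
    by (simp add: simplicial_boundary_def)
qed

text \<open>The coefficient at \<open>g\<close> is a sum over ordered pairs of vertices added to
  \<open>g\<close>. Swapping a pair keeps the resulting face and flips exactly one of the two signs,
  because only the larger vertex counts the smaller one.\<close>

lemma simplicial_boundary_boundary: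
  fixes c :: "'a set \<Rightarrow> 'k::field"
  assumes \<Gamma>: "simplicial_complex \<Gamma>" and c: "c \<in> supported \<Gamma>"
  shows "simplicial_boundary \<Gamma> (simplicial_boundary \<Gamma> c) = 0"
proof
  fix g :: "'a set"
  let ?V = "simplicial_vertices \<Gamma>"
  let ?lt = "\<lambda>u v. (u, v) \<in> (vertex_order :: 'a rel)"
  let ?s = "\<lambda>g v. (- 1 :: 'k) ^ card {u \<in> g. ?lt u v}"
  let ?t = "\<lambda>(v, u). ?s g v * (?s (insert v g) u * c (insert u (insert v g)))"
  have lin: "antisym (vertex_order :: 'a rel)" "total (vertex_order :: 'a rel)"
    using linear_order_vertex_order[where 'a = 'a]
    by (auto simp: linear_order_on_def partial_order_on_def)
  have fV: "finite ?V"
    using \<Gamma> by (auto simp: simplicial_complex_def simplicial_vertices_def)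
  let ?P = "{(v, u). v \<in> ?V - g \<and> u \<in> ?V - g \<and> u \<noteq> v}"
  let ?L = "{(v, u) \<in> ?P. ?lt v u}" and ?G = "{(v, u) \<in> ?P. ?lt u v}"
  have fP: "finite ?P"
    by (rule finite_subset[of _ "?V \<times> ?V"]) (use fV in auto)
  have "simplicial_boundary \<Gamma> (simplicial_boundary \<Gamma> c) g = (\<Sum>v\<in>?V - g. \<Sum>u\<in>?V - insert v g. ?t (v, u))"
    by (simp add: simplicial_boundary_def sum_distrib_left)
  also have "\<dots> = sum ?t (Sigma (?V - g) (\<lambda>v. ?V - insert v g))"
    using fV by (subst sum.Sigma) auto
  also have "Sigma (?V - g) (\<lambda>v. ?V - insert v g) = ?P"
    by auto
  also have "?P = ?L \<union> ?G"
    using lin(2) by (auto simp: total_on_def)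
  also have "sum ?t (?L \<union> ?G) = sum ?t ?L + sum ?t ?G"
  proof (rule sum.union_disjoint)
    show "finite ?L" "finite ?G" using fP by (auto intro: finite_subset[OF _ fP])
    show "?L \<inter> ?G = {}" using lin(1) by (auto simp: antisym_def)
  qed
  also have "sum ?t ?G = (\<Sum>p\<in>?L. ?t (prod.swap p))"
    by (rule sum.reindex_bij_witness[of _ prod.swap prod.swap]) auto
  also have "\<dots> = (\<Sum>p\<in>?L. - ?t p)"
  proof (rule sum.cong[OF refl])
    fix p assume "p \<in> ?L"
    then obtain v u where p: "p = (v, u)" "v \<notin> g" "u \<notin> g" "u \<noteq> v" "?lt v u" by auto
    then have nlt: "\<not> ?lt u v" using lin(1) by (auto simp: antisym_def)
    show "?t (prod.swap p) = - ?t p"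
    \<comment> \<open>A nonzero coefficient forces \<open>g\<close> to be finite, which the count of
      predecessors needs; otherwise both terms vanish.\<close>
    proof (cases "c (insert u (insert v g)) = 0")
      case True
      then show ?thesis using p by (simp add: insert_commute)
    next
      case False
      then have "insert u (insert v g) \<in> \<Gamma>"
        using c by (simp add: supported_def)
      then have "finite (insert u (insert v g))"
        by (rule simplicial_complexD(2)[OF \<Gamma>])
      then have fg: "finite g" by simp
      have "{x \<in> insert v g. ?lt x u} = insert v {x \<in> g. ?lt x u}"
        using p by auto
      then have 1: "?s (insert v g) u = - ?s g u"
        using fg p by simp
      have "{x \<in> insert u g. ?lt x v} = {x \<in> g. ?lt x v}"
        using nlt by auto
      then have 2: "?s (insert u g) v = ?s g v" by simp
      show ?thesis
        using p(1) 1 2 by (simp add: insert_commute)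
    qed
  qed
  also have "sum ?t ?L + (\<Sum>p\<in>?L. - ?t p) = 0"
    by (simp add: sum_negf)
  finally show "simplicial_boundary \<Gamma> (simplicial_boundary \<Gamma> c) g = 0 g" by simp
qed

section \<open>Reduced homology and the Euler-Poincare formula\<close>

lemma reduced_homology_zero_cycle:
  assumes "reduced_homology_zero TYPE('k::field) \<Gamma> i"
    and z: "z \<in> simplicial_cycles \<Gamma> i"
  shows "(z :: 'a set \<Rightarrow> 'k) \<in> simplicial_boundaries \<Gamma> i"
proof -
  have "(\<lambda>_. 0) \<in> simplicial_boundaries \<Gamma> i"
    by (auto simp: simplicial_boundaries_def simplicial_chains_def simplicial_boundary_def fun_eq_iff
        intro!: image_eqI[of _ _ "\<lambda>_. 0"])
  then have "z \<in> homology_coset \<Gamma> i z"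
    by (simp add: homology_coset_def)
  also have "homology_coset \<Gamma> i z = homology_coset \<Gamma> i (\<lambda>_. 0)"
    using assms by (auto simp: reduced_homology_zero_def reduced_homology_def)
  finally show ?thesis
    by (simp add: homology_coset_def)
qed

text \<open>Without chains one dimension higher, cosets are singletons and the homology is the space
  of cycles itself. The cycle \<open>z1\<close> with value \<open>1\<close> spans it:
  \<open>y\<close> and its multiple \<open>\<phi> {y}\<close> of \<open>z1\<close> have the same
  image.\<close>

lemma dim_top_cycles:
  assumes "reduced_homology_field TYPE('k::field) \<Gamma> i"
    and top: "\<And>c. c \<in> simplicial_chains \<Gamma> (i + 1) \<Longrightarrow> c = (\<lambda>_. 0 :: 'k)"
  shows "fs.dim (simplicial_cycles \<Gamma> i :: ('a set \<Rightarrow> 'k) set) = 1"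
proof -
  let ?Z = "simplicial_cycles \<Gamma> i :: ('a set \<Rightarrow> 'k) set"
  obtain \<phi> :: "('a set \<Rightarrow> 'k) set \<Rightarrow> 'k" where
    bij: "bij_betw \<phi> (reduced_homology \<Gamma> i) UNIV" and
    hom: "\<And>a z. z \<in> ?Z \<Longrightarrow>
      \<phi> (homology_coset \<Gamma> i (\<lambda>f. a * z f)) = a * \<phi> (homology_coset \<Gamma> i z)"
    using assms(1) unfolding reduced_homology_field_def by blast
  have bd: "simplicial_boundaries \<Gamma> i = {\<lambda>_. 0 :: 'k}"
    by (auto simp: simplicial_boundaries_def simplicial_boundary_def fun_eq_iff dest!: top
        intro!: image_eqI[of _ _ "\<lambda>_. 0"]) (simp add: simplicial_chains_def)
  have coset: "homology_coset \<Gamma> i z = {z}" for z :: "'a set \<Rightarrow> 'k"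
    by (auto simp: homology_coset_def bd fun_eq_iff)
  interpret D: Vector_Spaces.linear fscale fscale "simplicial_boundary \<Gamma> :: ('a set \<Rightarrow> 'k) \<Rightarrow> _"
    by (fact linear_simplicial_boundary)
  have scaleZ: "(\<lambda>f. a * z f) \<in> ?Z" if "z \<in> ?Z" for a z
  proof -
    have "simplicial_boundary \<Gamma> (fscale a z) = fscale a (simplicial_boundary \<Gamma> z)"
      by (rule D.scale)
    also have "simplicial_boundary \<Gamma> z = (\<lambda>_. 0)"
      using that by (simp add: simplicial_cycles_def)
    finally have "simplicial_boundary \<Gamma> (\<lambda>f. a * z f) = (\<lambda>_. 0)"
      by (simp only: fscale_def mult_zero_right)
    then show ?thesis
      using that by (simp add: simplicial_cycles_def simplicial_chains_def)
  qed
  have rh: "reduced_homology \<Gamma> i = (\<lambda>z. {z}) ` ?Z"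
    by (simp add: reduced_homology_def coset)
  have inj: "y = z" if "y \<in> ?Z" "z \<in> ?Z" "\<phi> {y} = \<phi> {z}" for y z
    using that bij by (auto simp: rh bij_betw_def inj_on_def)
  obtain z1 where z1: "z1 \<in> ?Z" "\<phi> {z1} = 1"
  proof -
    have "1 \<in> \<phi> ` reduced_homology \<Gamma> i"
      using bij by (simp add: bij_betw_def)
    then show ?thesis
      using that by (auto simp: rh)
  qed
  have "y \<in> fs.span {z1}" if "y \<in> ?Z" for y
  proof -
    have "y = fscale (\<phi> {y}) z1"
      using that scaleZ[OF z1(1)] hom[OF z1(1), of "\<phi> {y}"] z1
      unfolding fscale_def coset by (intro inj) auto
    also have "\<dots> \<in> fs.span {z1}"
      by (intro fs.span_scale fs.span_base) simp
    finally show ?thesis .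
  qed
  moreover have "z1 \<noteq> 0"
  proof
    assume "z1 = 0"
    then have "(\<lambda>f. 0 * z1 f) = z1" by auto
    then have "\<phi> {z1} = 0 * \<phi> {z1}"
      using hom[OF z1(1), of 0] by (simp only: coset)
    then show False
      using z1(2) by simp
  qed
  ultimately show ?thesis
    using z1(1) by (intro fs.dim_unique[of "{z1}"]) auto
qed

text \<open>Signs go by cardinality instead of dimension, so a sphere of dimension
  \<open>e - 1\<close> has value \<open>(-1)^e\<close>. The cycles in top degree are
  one-dimensional; below it, exactness makes the sum telescope.\<close>

lemma euler_poincare:
  fixes \<Gamma> :: "'a set set"
  assumes \<Gamma>: "simplicial_complex \<Gamma>" and le: "\<And>f. f \<in> \<Gamma> \<Longrightarrow> card f \<le> e"
    and zero: "\<And>i. i < int e - 1 \<Longrightarrow> reduced_homology_zero TYPE('k::field) \<Gamma> i"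
    and top: "reduced_homology_field TYPE('k) \<Gamma> (int e - 1)"
  shows "(\<Sum>f\<in>\<Gamma>. (- 1) ^ card f :: int) = (- 1) ^ e"
proof -
  define C :: "nat \<Rightarrow> ('a set \<Rightarrow> 'k) set" where "C n = supported {f\<in>\<Gamma>. card f = n}" for n
  let ?D = "simplicial_boundary \<Gamma> :: ('a set \<Rightarrow> 'k) \<Rightarrow> _"
  define Z where "Z n = {c\<in>C n. ?D c = 0}" for n
  have fin: "finite \<Gamma>" using \<Gamma> by (simp add: simplicial_complex_def)
  have Zcyc: "Z n = simplicial_cycles \<Gamma> (int n - 1)" for n
    by (simp add: Z_def C_def simplicial_cycles_def simplicial_chains_eq zero_fun_def)
  have rank: "int (card {f\<in>\<Gamma>. card f = n}) = int (fs.dim (Z n)) + int (fs.dim (?D ` C n))" for n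
  proof -
    have fin_n: "finite {f\<in>\<Gamma>. card f = n}" using fin by simp
    obtain W where "finite W" "C n \<subseteq> fs.span W"
      using supported_finite_span[OF fin_n] unfolding C_def by blast
    then have "fs.dim (C n) = fs.dim (Z n) + fs.dim (?D ` C n)"
      unfolding Z_def
      by (intro fsp.rank_nullity[OF linear_simplicial_boundary]) (auto simp: C_def subspace_supported)
    then show ?thesis
      by (simp add: C_def dim_supported[OF fin_n])
  qed
  have chains_Suc: "simplicial_chains \<Gamma> (int n) = C (Suc n)" for n
  proof -
    have "simplicial_chains \<Gamma> (int (Suc n) - 1) = C (Suc n)"
      by (simp only: simplicial_chains_eq C_def)
    then show ?thesis by simp
  qed
  have exact: "?D ` C (Suc n) = Z n" if "n < e" for n
  proof (intro equalityI subsetI)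
    fix c assume "c \<in> ?D ` C (Suc n)"
    then obtain b where b: "b \<in> C (Suc n)" "c = ?D b" by auto
    then have "b \<in> supported \<Gamma>" by (auto simp: C_def supported_def)
    then show "c \<in> Z n"
      using b simplicial_boundary_chain[OF \<Gamma>, of b n] simplicial_boundary_boundary[OF \<Gamma>]
      by (auto simp: Z_def C_def)
  next
    fix z assume "z \<in> Z n"
    then have "z \<in> simplicial_boundaries \<Gamma> (int n - 1)"
      using reduced_homology_zero_cycle[OF zero] that by (simp add: Zcyc)
    then show "z \<in> ?D ` C (Suc n)"
      by (simp add: simplicial_boundaries_def chains_Suc)
  qed
  \<comment> \<open>The number of faces of size \<open>Suc m\<close> is
    \<open>dim (Z (Suc m))\<close> plus the dimension of the boundaries, which by exactness is
    \<open>dim (Z m)\<close> and cancels the previous partial sum.\<close>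
  have "(\<Sum>n\<le>m. (- 1) ^ n * int (card {f\<in>\<Gamma>. card f = n})) = (- 1) ^ m * int (fs.dim (Z m))"
    if "m \<le> e" for m
    using that
  proof (induction m)
    case 0
    have "?D ` C 0 \<subseteq> {0}"
      using simplicial_boundary_0chain[OF \<Gamma>] by (auto simp: C_def)
    then have "fs.dim (?D ` C 0) = 0"
      by (metis fs.dim_unique empty_subsetI fs.span_empty fs.independent_empty card.empty)
    then show ?case by (simp add: rank)
  next
    case (Suc m)
    then have "?D ` C (Suc m) = Z m" by (intro exact) simp
    then show ?case using Suc by (simp add: rank algebra_simps)
  qed
  then have "(\<Sum>n\<le>e. (- 1) ^ n * int (card {f\<in>\<Gamma>. card f = n})) = (- 1) ^ e * int (fs.dim (Z e))"
    by simp
  moreover have "fs.dim (Z e) = 1"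
    unfolding Zcyc
  proof (rule dim_top_cycles[OF top])
    fix c :: "'a set \<Rightarrow> 'k" assume "c \<in> simplicial_chains \<Gamma> (int e - 1 + 1)"
    then show "c = (\<lambda>_. 0)"
      using le by (force simp: simplicial_chains_def fun_eq_iff)
  qed
  moreover have "(\<Sum>f\<in>\<Gamma>. (- 1) ^ card f :: int) = (\<Sum>n\<le>e. \<Sum>f\<in>{f\<in>\<Gamma>. card f = n}. (- 1) ^ card f)"
    using sum.group[of \<Gamma> "{..e}" card "\<lambda>f. (- 1) ^ card f :: int"] fin le by (simp add: image_subset_iff)
  moreover have "\<dots> = (\<Sum>n\<le>e. (- 1) ^ n * int (card {f\<in>\<Gamma>. card f = n}))"
    by (intro sum.cong) auto
  ultimately show ?thesis by simp
qed

section \<open>Flag complexes with spherical Euler characteristics\<close>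

abbreviation "verts \<equiv> simplicial_vertices"
abbreviation "lk \<equiv> simplicial_link"

lemma verts_iff: "simplicial_complex \<Delta> \<Longrightarrow> v \<in> verts \<Delta> \<longleftrightarrow> {v} \<in> \<Delta>"
  by (auto simp: simplicial_vertices_def intro: simplicial_complexD(4))

lemma finite_verts: "simplicial_complex \<Delta> \<Longrightarrow> finite (verts \<Delta>)"
  by (simp add: simplicial_vertices_def simplicial_complexD(1,2))

lemma link_empty [simp]: "lk \<Delta> {} = \<Delta>"
  by (auto simp: simplicial_link_def)

lemma link_complex:
  assumes "simplicial_complex \<Delta>" "F \<in> \<Delta>"
  shows "simplicial_complex (lk \<Delta> F)"
proof -
  have "g \<in> lk \<Delta> F" if "f \<in> lk \<Delta> F" "g \<subseteq> f" for f g
  proof -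
    have "g \<union> F \<subseteq> f \<union> F" using that by auto
    then show ?thesis
      using that simplicial_complexD(4)[OF assms(1)] unfolding simplicial_link_def by blast
  qed
  moreover have "lk \<Delta> F \<subseteq> \<Delta>" "{} \<in> lk \<Delta> F"
    using assms(2) simplicial_complexD(3)[OF assms(1)] by (auto simp: simplicial_link_def)
  ultimately show ?thesis
    using simplicial_complexD(1,2)[OF assms(1)] finite_subset
    unfolding simplicial_complex_def by blast
qed

lemma link_link:
  assumes "simplicial_complex \<Delta>" "G \<in> lk \<Delta> F"
  shows "lk (lk \<Delta> F) G = lk \<Delta> (F \<union> G)"
proof -
  have "H \<union> G \<in> \<Delta>" "H \<union> F \<in> \<Delta>" if "H \<union> (F \<union> G) \<in> \<Delta>" for H
    using that by (auto intro: simplicial_complexD(4)[OF assms(1)])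
  then show ?thesis
    using assms(2) by (auto simp: simplicial_link_def Un_ac)
qed

text \<open>The only consequence of the homology condition that matters is that the links have the
  Euler characteristic of a sphere.\<close>

definition euler_flag :: "nat \<Rightarrow> 'a set set \<Rightarrow> bool" where
  "euler_flag d \<Delta> \<longleftrightarrow>
     simplicial_complex \<Delta> \<and>
     (\<forall>f\<in>\<Delta>. \<exists>g\<in>\<Delta>. f \<subseteq> g \<and> card g = d) \<and>
     (\<forall>K\<subseteq>verts \<Delta>. (\<forall>u\<in>K. \<forall>v\<in>K. {u, v} \<in> \<Delta>) \<longrightarrow> K \<in> \<Delta>) \<and>
     (\<forall>f\<in>\<Delta>. (\<Sum>g\<in>lk \<Delta> f. (- 1) ^ card g :: int) = (- 1) ^ (d - card f))"

lemma euler_flagD: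
  assumes "euler_flag d \<Delta>"
  shows "simplicial_complex \<Delta>"
    and "f \<in> \<Delta> \<Longrightarrow> \<exists>g\<in>\<Delta>. f \<subseteq> g \<and> card g = d"
    and "K \<subseteq> verts \<Delta> \<Longrightarrow> (\<And>u v. u \<in> K \<Longrightarrow> v \<in> K \<Longrightarrow> u \<noteq> v \<Longrightarrow> {u, v} \<in> \<Delta>) \<Longrightarrow> K \<in> \<Delta>"
    and "f \<in> \<Delta> \<Longrightarrow> (\<Sum>g\<in>lk \<Delta> f. (- 1) ^ card g :: int) = (- 1) ^ (d - card f)"
proof -
  show \<Delta>: "simplicial_complex \<Delta>"
    using assms by (simp add: euler_flag_def)
  show "K \<in> \<Delta>" if K: "K \<subseteq> verts \<Delta>"
    and *: "\<And>u v. u \<in> K \<Longrightarrow> v \<in> K \<Longrightarrow> u \<noteq> v \<Longrightarrow> {u, v} \<in> \<Delta>"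
  proof -
    have "{u, v} \<in> \<Delta>" if "u \<in> K" "v \<in> K" for u v
      using *[OF that] that(1) K verts_iff[OF \<Delta>, of u] by (cases "u = v") auto
    then show ?thesis
      using assms K by (simp add: euler_flag_def)
  qed
qed (use assms in \<open>simp_all add: euler_flag_def\<close>)

lemma euler_flag_card_le:
  assumes "euler_flag d \<Delta>" "f \<in> \<Delta>"
  shows "card f \<le> d"
proof -
  obtain g where "g \<in> \<Delta>" "f \<subseteq> g" "card g = d"
    using euler_flagD(2)[OF assms] by auto
  then show ?thesis
    using card_mono[of g f] simplicial_complexD(2)[OF euler_flagD(1)[OF assms(1)]] by auto
qed

text \<open>A nonface whose pairs are all faces would contain a minimal nonface, which flagness
  makes a pair. The Euler condition is \<open>euler_poincare\<close> for the link, with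
  \<open>e = d - card f\<close>.\<close>

lemma homology_sphere_euler_flag:
  assumes "homology_sphere TYPE('k::field) d \<Delta>" "flag_complex \<Delta>"
  shows "euler_flag d \<Delta>"
proof -
  have \<Delta>: "simplicial_complex \<Delta>" and pure: "pure_complex d \<Delta>"
    using assms by (auto simp: homology_sphere_def)
  note cD = simplicial_complexD[OF \<Delta>]
  have facet: "\<exists>g\<in>\<Delta>. f \<subseteq> g \<and> card g = d" if f: "f \<in> \<Delta>" for f
  proof -
    obtain g where "g \<in> \<Delta>" "f \<subseteq> g" "\<forall>h\<in>\<Delta>. g \<subseteq> h \<longrightarrow> g = h"
      using finite_has_maximal2[OF cD(1) f] by auto
    then show ?thesis
      using pure unfolding pure_complex_def by metis
  qed
  have le: "card f \<le> d" if "f \<in> \<Delta>" for f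
    using facet[OF that] cD(2) by (metis card_mono)
  have flag: "K \<in> \<Delta>" if K: "K \<subseteq> verts \<Delta>" "\<forall>u\<in>K. \<forall>v\<in>K. {u, v} \<in> \<Delta>" for K
  proof (rule ccontr)
    assume "K \<notin> \<Delta>"
    have "finite K"
      using K(1) finite_verts[OF \<Delta>] by (rule finite_subset)
    then have "finite {s. s \<subseteq> K \<and> s \<notin> \<Delta>}" by simp
    then obtain s where s: "s \<subseteq> K" "s \<notin> \<Delta>" "\<forall>t. t \<subseteq> K \<and> t \<notin> \<Delta> \<longrightarrow> t \<subseteq> s \<longrightarrow> s = t"
      using finite_has_minimal[of "{s. s \<subseteq> K \<and> s \<notin> \<Delta>}"] \<open>K \<notin> \<Delta>\<close> by auto
    have "t \<in> \<Delta>" if "t \<subset> s" for t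
      using that s(1,3) by auto
    then have "minimal_nonface \<Delta> s"
      using K(1) s(1,2) by (auto simp: minimal_nonface_def)
    then have "card s = 2"
      using assms(2) by (simp add: flag_complex_def)
    then show False
      using s K by (auto simp: card_2_iff)
  qed
  have "(\<Sum>g\<in>lk \<Delta> f. (- 1) ^ card g :: int) = (- 1) ^ (d - card f)" if f: "f \<in> \<Delta>" for f
  proof (rule euler_poincare)
    have eq: "int (d - card f) - 1 = int d - 1 - int (card f)"
      using le[OF f] by simp
    show "simplicial_complex (lk \<Delta> f)" using link_complex[OF \<Delta> f] .
    show "reduced_homology_zero TYPE('k) (lk \<Delta> f) i" if "i < int (d - card f) - 1" for i
      using assms(1) f that eq unfolding homology_sphere_def by metis
    show "reduced_homology_field TYPE('k) (lk \<Delta> f) (int (d - card f) - 1)"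
      using assms(1) f eq unfolding homology_sphere_def by metis
    show "card g \<le> d - card f" if "g \<in> lk \<Delta> f" for g
    proof -
      have "card (g \<union> f) = card g + card f" "g \<union> f \<in> \<Delta>"
        using that f cD(2) by (auto simp: simplicial_link_def intro: card_Un_disjoint)
      then show ?thesis using le[of "g \<union> f"] by simp
    qed
  qed
  then show ?thesis
    using \<Delta> facet flag by (auto simp: euler_flag_def)
qed

text \<open>A clique of the link remains a clique after adding \<open>F\<close>, so flagness of the
  whole complex applies to the union. The Euler condition is inherited because a link in a link is a
  link in \<open>\<Delta>\<close>.\<close>

lemma euler_flag_link:
  assumes E: "euler_flag d \<Delta>" and F: "F \<in> \<Delta>"
  shows "euler_flag (d - card F) (lk \<Delta> F)"
proof -
  have \<Delta>: "simplicial_complex \<Delta>" using euler_flagD(1)[OF E] .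
  note cD = simplicial_complexD[OF \<Delta>]
  have L: "simplicial_complex (lk \<Delta> F)" using link_complex[OF \<Delta> F] .
  have pure: "\<exists>h\<in>lk \<Delta> F. g \<subseteq> h \<and> card h = d - card F" if g: "g \<in> lk \<Delta> F" for g
  proof -
    obtain h where h: "h \<in> \<Delta>" "g \<union> F \<subseteq> h" "card h = d"
      using g euler_flagD(2)[OF E, of "g \<union> F"] by (auto simp: simplicial_link_def)
    have "h - F \<in> \<Delta>" using h cD(4) by auto
    moreover have "(h - F) \<union> F = h" using h by auto
    ultimately have "h - F \<in> lk \<Delta> F" using h by (auto simp: simplicial_link_def)
    moreover have "card (h - F) = d - card F"
      using h cD(2)[OF F] by (simp add: card_Diff_subset)
    moreover have "g \<subseteq> h - F"
      using h that by (auto simp: simplicial_link_def)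
    ultimately show ?thesis by auto
  qed
  have flag: "K \<in> lk \<Delta> F" if K: "K \<subseteq> verts (lk \<Delta> F)" "\<forall>u\<in>K. \<forall>v\<in>K. {u, v} \<in> lk \<Delta> F" for K
  proof -
    have *: "insert u F \<in> \<Delta>" "u \<notin> F" if "u \<in> K" for u
      using that K verts_iff[OF L, of u] by (auto simp: simplicial_link_def)
    have "K \<union> F \<in> \<Delta>"
    proof (rule euler_flagD(3)[OF E])
      show "K \<union> F \<subseteq> verts \<Delta>"
        using * F by (auto simp: simplicial_vertices_def)
      show "{u, v} \<in> \<Delta>" if "u \<in> K \<union> F" "v \<in> K \<union> F" for u v
      proof -
        consider "u \<in> K" "v \<in> K" | "u \<in> K" "v \<in> F" | "u \<in> F" "v \<in> K" | "u \<in> F" "v \<in> F"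
          using \<open>u \<in> K \<union> F\<close> \<open>v \<in> K \<union> F\<close> by auto
        then show ?thesis
        proof cases
          case 1 then show ?thesis using K by (auto simp: simplicial_link_def)
        next
          case 2 then show ?thesis using *(1)[of u] by (auto intro: cD(4))
        next
          case 3 then show ?thesis using *(1)[of v] by (auto intro: cD(4))
        next
          case 4 then show ?thesis using F by (auto intro: cD(4))
        qed
      qed
    qed
    then show ?thesis
      using * cD(4)[of "K \<union> F" K] by (auto simp: simplicial_link_def)
  qed
  have euler: "(\<Sum>g\<in>lk (lk \<Delta> F) G. (- 1) ^ card g :: int) = (- 1) ^ (d - card F - card G)"
    if G: "G \<in> lk \<Delta> F" for G
  proof -
    have "card (F \<union> G) = card F + card G"
      using G F cD(2) by (intro card_Un_disjoint) (auto simp: simplicial_link_def)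
    moreover have "F \<union> G \<in> \<Delta>"
      using G by (simp add: simplicial_link_def Un_commute)
    ultimately show ?thesis
      using euler_flagD(4)[OF E, of "F \<union> G"] link_link[OF \<Delta> G] by simp
  qed
  show ?thesis
    unfolding euler_flag_def using L pure flag euler by blast
qed

text \<open>Sets avoiding \<open>v\<close> are paired with the same sets plus \<open>v\<close>. The
  values needed are \<open>x = -1\<close>, where a cone sums to \<open>0\<close>, and
  \<open>x = -1/2\<close>, where it has half of the weight of its base.\<close>

lemma sum_cone:
  fixes x :: "'b::comm_semiring_1"
  assumes "finite A" and fin: "\<And>F. F \<in> A \<Longrightarrow> finite F"
    and A: "\<And>F. F \<in> A \<Longrightarrow> insert v F \<in> A" "\<And>F. F \<in> A \<Longrightarrow> F - {v} \<in> A"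
  shows "(\<Sum>F\<in>A. x ^ card F) = (1 + x) * (\<Sum>F\<in>{F\<in>A. v \<notin> F}. x ^ card F)"
proof -
  have "(\<Sum>F\<in>A. x ^ card F) = (\<Sum>F\<in>{F\<in>A. v \<notin> F}. x ^ card F) + (\<Sum>F\<in>{F\<in>A. v \<in> F}. x ^ card F)"
    using assms(1) by (subst sum.union_disjoint[symmetric]) (auto intro!: sum.cong)
  also have "(\<Sum>F\<in>{F\<in>A. v \<in> F}. x ^ card F) = (\<Sum>F\<in>{F\<in>A. v \<notin> F}. x ^ card (insert v F))"
    by (rule sum.reindex_bij_witness[of _ "insert v" "\<lambda>F. F - {v}"]) (auto simp: A insert_absorb)
  also have "\<dots> = (\<Sum>F\<in>{F\<in>A. v \<notin> F}. x * x ^ card F)"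
    using fin by (intro sum.cong) auto
  finally show ?thesis
    by (simp add: sum_distrib_left algebra_simps sum.distrib)
qed

section \<open>Non-neighbours and vertex counts of links\<close>

definition nonneighbours :: "'a set set \<Rightarrow> 'a \<Rightarrow> 'a set" where
  "nonneighbours \<Delta> v = {u \<in> verts \<Delta>. u \<noteq> v \<and> {u, v} \<notin> \<Delta>}"

text \<open>By flagness a vertex adjacent to all others would make the complex a cone, whose
  alternating sum is \<open>0\<close> and not a sign.\<close>

lemma nonneighbours_nonempty:
  assumes E: "euler_flag d \<Delta>" and v: "v \<in> verts \<Delta>"
  shows "nonneighbours \<Delta> v \<noteq> {}"
proof
  assume "nonneighbours \<Delta> v = {}"
  then have adj: "{u, v} \<in> \<Delta>" if "u \<in> verts \<Delta>" "u \<noteq> v" for u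
    using that by (auto simp: nonneighbours_def)
  have \<Delta>: "simplicial_complex \<Delta>" using euler_flagD(1)[OF E] .
  note cD = simplicial_complexD[OF \<Delta>]
  have cone: "insert v F \<in> \<Delta>" if F: "F \<in> \<Delta>" for F
  proof (rule euler_flagD(3)[OF E])
    have FV: "F \<subseteq> verts \<Delta>" using F by (auto simp: simplicial_vertices_def)
    then show "insert v F \<subseteq> verts \<Delta>" using v by simp
    show "{u, w} \<in> \<Delta>" if "u \<in> insert v F" "w \<in> insert v F" "u \<noteq> w" for u w
      using that FV adj[of u] adj[of w] cD(4)[OF F, of "{u, w}"] by (auto simp: insert_commute)
  qed
  have "(\<Sum>F\<in>\<Delta>. (- 1) ^ card F :: int) = 0"
    using sum_cone[OF cD(1), where v = v and x = "- 1 :: int"] cone cD(2,4) by auto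
  moreover have "(\<Sum>F\<in>\<Delta>. (- 1) ^ card F :: int) = (- 1) ^ d"
    using euler_flagD(4)[OF E cD(3)] by simp
  ultimately show False by simp
qed

lemma verts_link_vertex:
  assumes "simplicial_complex \<Delta>"
  shows "{v} \<in> \<Delta> \<Longrightarrow> verts (lk \<Delta> {v}) = {u. u \<noteq> v \<and> {u, v} \<in> \<Delta>}"
  using verts_iff[OF link_complex[OF assms, of "{v}"]] simplicial_complexD(4)[OF assms]
  by (auto simp: simplicial_link_def)

lemma card_verts_vertex:
  assumes \<Delta>: "simplicial_complex \<Delta>" and v: "v \<in> verts \<Delta>"
  shows "card (verts \<Delta>) = card (verts (lk \<Delta> {v})) + 1 + card (nonneighbours \<Delta> v)"
proof -
  have L: "verts (lk \<Delta> {v}) = {u. u \<noteq> v \<and> {u, v} \<in> \<Delta>}"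
    using verts_link_vertex[OF \<Delta>] v verts_iff[OF \<Delta>] by simp
  have sub: "verts (lk \<Delta> {v}) \<subseteq> verts \<Delta>"
    by (auto simp: simplicial_vertices_def simplicial_link_def)
  have "verts \<Delta> = insert v (verts (lk \<Delta> {v}) \<union> nonneighbours \<Delta> v)"
    using sub v by (auto simp: L nonneighbours_def)
  moreover have "finite (verts (lk \<Delta> {v}))" "finite (nonneighbours \<Delta> v)"
    using finite_verts[OF \<Delta>] sub finite_subset by (auto simp: nonneighbours_def)
  moreover have "v \<notin> verts (lk \<Delta> {v}) \<union> nonneighbours \<Delta> v"
    "verts (lk \<Delta> {v}) \<inter> nonneighbours \<Delta> v = {}"
    by (auto simp: L nonneighbours_def)
  ultimately show ?thesis
    by (simp add: card_Un_disjoint)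
qed

text \<open>Each passage to the link of a further vertex of \<open>F\<close> loses that vertex and
  at least one non-neighbour of it.\<close>

lemma card_verts_link:
  assumes "euler_flag d \<Delta>" "F \<in> \<Delta>"
  shows "card (verts (lk \<Delta> F)) + 2 * card F \<le> card (verts \<Delta>)"
proof -
  have "finite F"
    using assms simplicial_complexD(2)[OF euler_flagD(1)] by blast
  then show ?thesis
    using assms
  proof (induction F arbitrary: d \<Delta> rule: finite_induct)
    case empty
    then show ?case by simp
  next
    case (insert a F)
    have \<Delta>: "simplicial_complex \<Delta>" using euler_flagD(1)[OF insert.prems(1)] .
    have a: "{a} \<in> \<Delta>" and F: "F \<in> lk \<Delta> {a}"
      using insert.prems insert.hyps simplicial_complexD(4)[OF \<Delta> insert.prems(2)]
      by (auto simp: simplicial_link_def)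
    have av: "a \<in> verts \<Delta>" using a verts_iff[OF \<Delta>] by simp
    have "finite (nonneighbours \<Delta> a)"
      using finite_verts[OF \<Delta>] by (simp add: nonneighbours_def)
    then have "card (verts (lk \<Delta> {a})) + 2 \<le> card (verts \<Delta>)"
      using card_verts_vertex[OF \<Delta> av] nonneighbours_nonempty[OF insert.prems(1) av]
      by (simp add: card_gt_0_iff Suc_le_eq)
    moreover have "card (verts (lk (lk \<Delta> {a}) F)) + 2 * card F \<le> card (verts (lk \<Delta> {a}))"
      using insert.IH[OF euler_flag_link[OF insert.prems(1) a] F] .
    ultimately show ?case
      using insert.hyps link_link[OF \<Delta> F] by simp
  qed
qed

text \<open>The same count, started inside the link of \<open>a\<close>. It compares the link of a
  face with a single vertex link, so that a bound on all vertex degrees can be inserted.\<close>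

lemma card_verts_link_vertex:
  assumes E: "euler_flag d \<Delta>" and F: "F \<in> \<Delta>" "a \<in> F"
  shows "card (verts (lk \<Delta> F)) + 2 * (card F - 1) \<le> card (verts (lk \<Delta> {a}))"
proof -
  have \<Delta>: "simplicial_complex \<Delta>" using euler_flagD(1)[OF E] .
  have ins: "{a} \<union> (F - {a}) = F" using F by auto
  have a: "{a} \<in> \<Delta>" and F': "F - {a} \<in> lk \<Delta> {a}"
    using simplicial_complexD(4)[OF \<Delta> F(1)] F ins by (auto simp: simplicial_link_def insert_absorb)
  have "lk (lk \<Delta> {a}) (F - {a}) = lk \<Delta> F"
    using link_link[OF \<Delta> F'] ins by simp
  moreover have "card (F - {a}) = card F - 1"
    using F simplicial_complexD(2)[OF \<Delta>] by simp
  ultimately show ?thesis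
    using card_verts_link[OF euler_flag_link[OF E a] F'] by simp
qed

text \<open>The cross-polytope bound, by the link count at a face with \<open>d\<close> elements. It
  makes the excess over \<open>2d\<close> a natural number for every link.\<close>

lemma card_verts_ge:
  assumes "euler_flag d \<Delta>"
  shows "2 * d \<le> card (verts \<Delta>)"
proof -
  obtain g where "g \<in> \<Delta>" "card g = d"
    using euler_flagD(2)[OF assms] simplicial_complexD(3)[OF euler_flagD(1)[OF assms]] by blast
  then show ?thesis
    using card_verts_link[OF assms] by force
qed

text \<open>The join inside one vertex type, intended for factors on disjoint vertex sets;
  \<open>simplicial_isomorphic_join\<close> compares it with the encoded join on
  \<open>nat\<close>.\<close>

definition face_join :: "'a set set \<Rightarrow> 'a set set \<Rightarrow> 'a set set" where
  "face_join A B = {f \<union> g | f g. f \<in> A \<and> g \<in> B}"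

text \<open>Every neighbour \<open>u\<close> of \<open>v\<close> is also adjacent to
  \<open>w\<close>: in the link of \<open>u\<close>, the vertex \<open>v\<close> has a
  non-neighbour, which by flagness is a non-neighbour of \<open>v\<close> in \<open>\<Delta>\<close>
  and hence \<open>w\<close>. Flagness then fills in all faces of the suspension.\<close>

lemma unique_antipode_suspension:
  assumes E: "euler_flag d \<Delta>" and v: "v \<in> verts \<Delta>" and U: "nonneighbours \<Delta> v = {w}"
  shows "\<Delta> = face_join {{}, {v}, {w}} (lk \<Delta> {v})"
proof -
  have \<Delta>: "simplicial_complex \<Delta>" using euler_flagD(1)[OF E] .
  note cD = simplicial_complexD[OF \<Delta>]
  have w: "w \<in> verts \<Delta>" "w \<noteq> v" "{w, v} \<notin> \<Delta>" using U by (auto simp: nonneighbours_def)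
  have adj_v: "{u, v} \<in> \<Delta>" if "u \<in> verts \<Delta>" "u \<noteq> v" "u \<noteq> w" for u
    using that U by (auto simp: nonneighbours_def)
  have adj_w: "{u, w} \<in> \<Delta>" if u: "{u, v} \<in> \<Delta>" "u \<noteq> v" for u
  proof -
    have u1: "{u} \<in> \<Delta>" using cD(4)[OF u(1)] by simp
    have vl: "v \<in> verts (lk \<Delta> {u})"
      using verts_link_vertex[OF \<Delta> u1] u by (auto simp: insert_commute)
    obtain x where x: "x \<in> verts (lk \<Delta> {u})" "x \<noteq> v" "{x, v} \<notin> lk \<Delta> {u}"
      using nonneighbours_nonempty[OF euler_flag_link[OF E u1] vl] by (auto simp: nonneighbours_def)
    have xu: "x \<noteq> u" "{x, u} \<in> \<Delta>" using x(1) verts_link_vertex[OF \<Delta> u1] by auto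
    have "x = w"
    proof (rule ccontr)
      assume "x \<noteq> w"
      moreover have "x \<in> verts \<Delta>" using xu cD(4)[OF xu(2), of "{x}"] verts_iff[OF \<Delta>] by simp
      ultimately have xv: "{x, v} \<in> \<Delta>" using adj_v x(2) by simp
      have "{x, v, u} \<in> \<Delta>"
      proof (rule euler_flagD(3)[OF E])
        show "{x, v, u} \<subseteq> verts \<Delta>" using xu xv u by (auto simp: simplicial_vertices_def)
      qed (use xu xv u in \<open>auto simp: insert_commute\<close>)
      then have "{x, v} \<in> lk \<Delta> {u}"
        using xv xu u by (auto simp: simplicial_link_def insert_commute)
      then show False using x(3) by simp
    qed
    then show ?thesis using xu by (simp add: insert_commute)
  qed
  show ?thesis
  proof (intro equalityI subsetI)
    fix F assume F: "F \<in> \<Delta>"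
    have FV: "F \<subseteq> verts \<Delta>" using F by (auto simp: simplicial_vertices_def)
    have link: "F - {v, w} \<in> lk \<Delta> {v}"
    proof -
      have "insert v (F - {v, w}) \<in> \<Delta>"
      proof (rule euler_flagD(3)[OF E])
        show "insert v (F - {v, w}) \<subseteq> verts \<Delta>" using FV v by auto
        show "{a, b} \<in> \<Delta>" if "a \<in> insert v (F - {v, w})" "b \<in> insert v (F - {v, w})" "a \<noteq> b" for a b
          using that FV adj_v[of a] adj_v[of b] cD(4)[OF F, of "{a, b}"] by (auto simp: insert_commute)
      qed
      then show ?thesis
        using cD(4)[OF F, of "F - {v, w}"] by (auto simp: simplicial_link_def)
    qed
    have "\<not> (v \<in> F \<and> w \<in> F)" using w cD(4)[OF F, of "{w, v}"] by auto
    then have "F \<inter> {v, w} \<in> {{}, {v}, {w}}" by auto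
    moreover have "F = (F \<inter> {v, w}) \<union> (F - {v, w})" by auto
    ultimately show "F \<in> face_join {{}, {v}, {w}} (lk \<Delta> {v})"
      unfolding face_join_def using link by blast
  next
    fix F assume "F \<in> face_join {{}, {v}, {w}} (lk \<Delta> {v})"
    then obtain f g where F: "F = f \<union> g" "f \<in> {{}, {v}, {w}}" and g: "g \<in> lk \<Delta> {v}"
      by (auto simp: face_join_def)
    have g': "g \<in> \<Delta>" "insert v g \<in> \<Delta>" "v \<notin> g" using g by (auto simp: simplicial_link_def)
    have "insert w g \<in> \<Delta>"
    proof (rule euler_flagD(3)[OF E])
      show "insert w g \<subseteq> verts \<Delta>" using g' w by (auto simp: simplicial_vertices_def)
      have "{u, w} \<in> \<Delta>" if "u \<in> g" for u
        using that g' by (intro adj_w) (auto intro: cD(4))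
      then show "{a, b} \<in> \<Delta>" if "a \<in> insert w g" "b \<in> insert w g" "a \<noteq> b" for a b
        using that cD(4)[OF g'(1), of "{a, b}"] by (auto simp: insert_commute)
    qed
    then show "F \<in> \<Delta>" using F g' by auto
  qed
qed

section \<open>The gamma vector and vertex links\<close>

definition hpoly :: "nat \<Rightarrow> 'a set set \<Rightarrow> int poly" where
  "hpoly d \<Delta> = (\<Sum>F\<in>\<Delta>. [:- 1, 1:] ^ (d - card F))"

lemma h_polynomial_eq_hpoly:
  assumes "finite \<Delta>" "\<And>F. F \<in> \<Delta> \<Longrightarrow> card F \<le> d"
  shows "h_polynomial d \<Delta> = hpoly d \<Delta>"
proof -
  have "hpoly d \<Delta> = (\<Sum>i\<le>d. \<Sum>F\<in>{F\<in>\<Delta>. card F = i}. [:- 1, 1:] ^ (d - card F))"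
    unfolding hpoly_def
    using sum.group[of \<Delta> "{..d}" card "\<lambda>F. [:- 1, 1 :: int:] ^ (d - card F)"] assms
    by (simp add: image_subset_iff)
  also have "\<dots> = h_polynomial d \<Delta>"
    unfolding h_polynomial_def face_number_def by (intro sum.cong) auto
  finally show ?thesis by simp
qed

section \<open>Gamma expansions of palindromic polynomials\<close>

definition gamma_expansion :: "nat \<Rightarrow> int poly \<Rightarrow> (nat \<Rightarrow> int) \<Rightarrow> bool" where
  "gamma_expansion d p \<gamma> \<longleftrightarrow>
     p = (\<Sum>i\<le>d div 2. of_int (\<gamma> i) * [:0, 1:] ^ i * [:1, 1:] ^ (d - 2 * i)) \<and>
     (\<forall>j > d div 2. \<gamma> j = 0)"

text \<open>Evaluation at \<open>0\<close> isolates \<open>a 0\<close>; what remains is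
  \<open>z\<close> times a sum of the same form for \<open>d - 2\<close>.\<close>

lemma gamma_expansion_zero:
  assumes "2 * n \<le> d" "(\<Sum>i\<le>n. of_int (a i) * [:0, 1:] ^ i * [:1, 1:] ^ (d - 2 * i)) = (0 :: int poly)"
    and "i \<le> n"
  shows "a i = 0"
  using assms
proof (induction n arbitrary: a d i)
  case 0
  have "poly (of_int (a 0) * [:0, 1:] ^ 0 * [:1, 1:] ^ d) 0 = (0 :: int)"
    using 0 by simp
  then show ?case using 0 by simp
next
  case (Suc n)
  let ?S = "\<Sum>i\<le>n. of_int (a (Suc i)) * [:0, 1:] ^ i * [:1, 1:] ^ (d - 2 - 2 * i) :: int poly"
  have eq: "of_int (a 0) * [:1, 1:] ^ d + [:0, 1:] * ?S = 0"
    using Suc.prems(2) unfolding sum.atMost_Suc_shift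
    by (simp add: sum_distrib_left algebra_simps)
  then have "poly (of_int (a 0) * [:1, 1:] ^ d + [:0, 1:] * ?S) 0 = 0"
    by simp
  then have a0: "a 0 = 0" by simp
  then have "?S = 0"
    using eq by simp
  then have "a (Suc j) = 0" if "j \<le> n" for j
    using Suc.IH[of "d - 2" "\<lambda>i. a (Suc i)" j] Suc.prems(1) that by simp
  then show ?case
    using a0 Suc.prems(3) by (cases i) auto
qed

lemma gamma_expansion_unique:
  assumes "gamma_expansion d p \<gamma>" "gamma_expansion d p \<delta>"
  shows "\<gamma> = \<delta>"
proof
  fix i
  show "\<gamma> i = \<delta> i"
  proof (cases "i \<le> d div 2")
    case True
    have "(\<Sum>i\<le>d div 2. of_int (\<gamma> i - \<delta> i) * [:0, 1:] ^ i * [:1, 1:] ^ (d - 2 * i)) =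
      (\<Sum>i\<le>d div 2. of_int (\<gamma> i) * [:0, 1:] ^ i * [:1, 1:] ^ (d - 2 * i)) -
      (\<Sum>i\<le>d div 2. of_int (\<delta> i) * [:0, 1 :: int:] ^ i * [:1, 1:] ^ (d - 2 * i))"
      by (simp only: of_int_diff left_diff_distrib sum_subtractf)
    also have "\<dots> = p - p"
      using assms unfolding gamma_expansion_def by metis
    finally show ?thesis
      using gamma_expansion_zero[of "d div 2" d "\<lambda>i. \<gamma> i - \<delta> i" i] True by simp
  qed (use assms in \<open>auto simp: gamma_expansion_def\<close>)
qed

text \<open>Subtracting \<open>c (1 + z)^d\<close> removes the constant coefficient and, by
  symmetry, the one in degree \<open>d\<close>. The difference divided by \<open>z\<close> is
  palindromic for \<open>d - 2\<close>.\<close>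

lemma gamma_expansion_exists:
  fixes p :: "int poly"
  assumes "\<And>k. k > d \<Longrightarrow> coeff p k = 0" "\<And>k. k \<le> d \<Longrightarrow> coeff p k = coeff p (d - k)"
  shows "\<exists>\<gamma>. gamma_expansion d p \<gamma>"
  using assms
proof (induction d arbitrary: p rule: less_induct)
  case (less d)
  define c where "c = coeff p 0"
  consider "d = 0" | "d = 1" | "d \<ge> 2" by linarith
  then show ?case
  proof cases
    case 1
    have "p = of_int c"
      using less.prems(1) 1 by (intro poly_eqI) (auto simp: c_def of_int_poly coeff_pCons split: nat.split)
    then show ?thesis
      using 1 by (intro exI[of _ "\<lambda>i. if i = 0 then c else 0"]) (auto simp: gamma_expansion_def)
  next
    case 2
    have "p = of_int c * [:1, 1:]"
    proof (rule poly_eqI)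
      fix k :: nat
      have "k = 0 \<or> k = 1 \<or> k > 1" by (cases k) auto
      then show "coeff p k = coeff (of_int c * [:1, 1:]) k"
        using less.prems(1)[of k] less.prems(2)[of 1] 2
        by (auto simp: c_def of_int_poly coeff_pCons split: nat.split)
    qed
    then show ?thesis
      using 2 by (intro exI[of _ "\<lambda>i. if i = 0 then c else 0"]) (auto simp: gamma_expansion_def)
  next
    case 3
    define q where "q = p - of_int c * [:1, 1:] ^ d"
    have cq: "coeff q k = coeff p k - c * of_nat (d choose k)" for k
      by (cases "k \<le> d")
        (auto simp: q_def of_int_poly coeff_linear_poly_power coeff_eq_0 degree_linear_power binomial_eq_0)
    have q: "coeff q k = 0" if "k > d" for k
      using that less.prems(1) by (simp add: cq binomial_eq_0)
    have sym: "coeff q k = coeff q (d - k)" if "k \<le> d" for k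
      by (simp only: cq less.prems(2)[OF that, symmetric] binomial_symmetric[OF that, symmetric])
    have q0: "coeff q 0 = 0" by (simp add: cq c_def)
    then have qd: "coeff q d = 0" using sym[of 0] by simp
    define r where "r = poly_shift 1 q"
    have cr: "coeff r k = coeff q (Suc k)" for k by (simp add: r_def coeff_poly_shift)
    have "q = [:0, 1:] * r"
      by (rule poly_eqI) (auto simp: coeff_pCons cr q0 split: nat.split)
    have "\<exists>\<gamma>. gamma_expansion (d - 2) r \<gamma>"
    proof (rule less.IH)
      show "coeff r k = 0" if "k > d - 2" for k
        using that q[of "Suc k"] qd by (cases "Suc k = d") (auto simp: cr)
      show "coeff r k = coeff r (d - 2 - k)" if "k \<le> d - 2" for k
      proof -
        have "d - Suc k = Suc (d - 2 - k)" using that 3 by simp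
        moreover have "coeff q (Suc k) = coeff q (d - Suc k)" using that 3 by (intro sym) simp
        ultimately show ?thesis by (simp only: cr)
      qed
    qed (use 3 in simp)
    then obtain \<gamma> where \<gamma>: "gamma_expansion (d - 2) r \<gamma>" by auto
    have d: "d div 2 = Suc ((d - 2) div 2)" using 3 by simp
    have "p = of_int c * [:1, 1:] ^ d + [:0, 1:] * r"
      using \<open>q = [:0, 1:] * r\<close> by (simp add: q_def algebra_simps)
    also have "[:0, 1:] * r = (\<Sum>i\<le>(d - 2) div 2. of_int (\<gamma> i) * [:0, 1:] ^ Suc i * [:1, 1:] ^ (d - 2 * Suc i))"
      using \<gamma> unfolding gamma_expansion_def by (simp add: sum_distrib_left algebra_simps)
    finally have "gamma_expansion d p (case_nat c \<gamma>)"
      using \<gamma> unfolding gamma_expansion_def d sum.atMost_Suc_shift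
      by (auto split: nat.split)
    then show ?thesis by auto
  qed
qed

section \<open>Vertex links and the Dehn-Sommerville relations\<close>

lemma pderiv_sum: "pderiv (\<Sum>i\<in>I. p i) = (\<Sum>i\<in>I. pderiv (p i))"
  by (induction I rule: infinite_finite_induct) (auto simp: pderiv_add)

text \<open>A face \<open>F\<close> arises from each of its \<open>card F\<close> vertices. With
  \<open>y = z - 1\<close> and \<open>m = Suc n - card F\<close>, the operator
  \<open>(1 - z) d/dz\<close> multiplies \<open>y^m\<close> by \<open>-m\<close>, and
  \<open>Suc n - m = card F\<close>.\<close>

lemma sum_hpoly_links:
  assumes \<Delta>: "simplicial_complex \<Delta>" and le: "\<And>F. F \<in> \<Delta> \<Longrightarrow> card F \<le> Suc n"
  shows "(\<Sum>v\<in>verts \<Delta>. hpoly n (lk \<Delta> {v})) =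
    of_nat (Suc n) * hpoly (Suc n) \<Delta> + [:1, - 1:] * pderiv (hpoly (Suc n) \<Delta>)"
proof -
  note cD = simplicial_complexD[OF \<Delta>]
  let ?y = "[:- 1, 1 :: int:]"
  have "hpoly n (lk \<Delta> {v}) = (\<Sum>F\<in>{F\<in>\<Delta>. v \<in> F}. ?y ^ (Suc n - card F))" for v
    unfolding hpoly_def
  proof (rule sum.reindex_bij_witness[of _ "\<lambda>F. F - {v}" "insert v"])
    fix F assume F: "F \<in> {F\<in>\<Delta>. v \<in> F}"
    then have "F - {v} \<in> \<Delta>" "insert v (F - {v}) = F" using cD(4) by auto
    then show "F - {v} \<in> lk \<Delta> {v}" "insert v (F - {v}) = F"
      using F by (auto simp: simplicial_link_def)
  next
    fix G assume "G \<in> lk \<Delta> {v}"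
    then have G: "G \<in> \<Delta>" "v \<notin> G" "insert v G \<in> \<Delta>" by (auto simp: simplicial_link_def)
    then show "insert v G - {v} = G" "insert v G \<in> {F\<in>\<Delta>. v \<in> F}" by auto
    show "?y ^ (Suc n - card (insert v G)) = ?y ^ (n - card G)"
      using G cD(2) by simp
  qed
  then have "(\<Sum>v\<in>verts \<Delta>. hpoly n (lk \<Delta> {v})) =
      (\<Sum>v\<in>verts \<Delta>. \<Sum>F\<in>{F\<in>\<Delta>. v \<in> F}. ?y ^ (Suc n - card F))"
    by simp
  also have "\<dots> = (\<Sum>F\<in>\<Delta>. \<Sum>v\<in>{v\<in>verts \<Delta>. v \<in> F}. ?y ^ (Suc n - card F))"
    using finite_verts[OF \<Delta>] cD(1) by (rule sum.swap_restrict)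
  also have "\<dots> = (\<Sum>F\<in>\<Delta>. of_nat (card F) * ?y ^ (Suc n - card F))"
  proof (rule sum.cong[OF refl])
    fix F assume "F \<in> \<Delta>"
    then have "{v\<in>verts \<Delta>. v \<in> F} = F" by (auto simp: simplicial_vertices_def)
    then show "(\<Sum>v\<in>{v\<in>verts \<Delta>. v \<in> F}. ?y ^ (Suc n - card F)) = of_nat (card F) * ?y ^ (Suc n - card F)"
      by simp
  qed
  also have "\<dots> = (\<Sum>F\<in>\<Delta>. of_nat (Suc n) * ?y ^ (Suc n - card F) + [:1, - 1:] * pderiv (?y ^ (Suc n - card F)))"
  proof (rule sum.cong[OF refl])
    fix F assume "F \<in> \<Delta>"
    then obtain m where m: "Suc n = card F + m" using le le_Suc_ex by blast
    have "[:1, - 1:] * pderiv (?y ^ m) = - of_nat m * ?y ^ m"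
    proof (cases m)
      case (Suc k)
      have "pderiv (?y ^ m) = of_nat m * ?y ^ k"
        by (simp only: Suc pderiv_power_Suc) (simp add: pderiv_pCons of_nat_poly)
      moreover have "[:1, - 1 :: int:] = - ?y" by simp
      ultimately show ?thesis
        by (simp only: Suc power_Suc) (simp only: mult_minus_left mult_ac)
    qed simp
    then show "of_nat (card F) * ?y ^ (Suc n - card F) =
      of_nat (Suc n) * ?y ^ (Suc n - card F) + [:1, - 1:] * pderiv (?y ^ (Suc n - card F))"
      unfolding m by (simp add: algebra_simps)
  qed
  also have "\<dots> = of_nat (Suc n) * hpoly (Suc n) \<Delta> + [:1, - 1:] * pderiv (hpoly (Suc n) \<Delta>)"
    by (simp only: hpoly_def sum.distrib sum_distrib_left pderiv_sum)
  finally show ?thesis .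
qed

lemma coeff_hpoly_gt: "k > d \<Longrightarrow> coeff (hpoly d \<Delta>) k = 0"
  by (auto simp: hpoly_def coeff_sum degree_linear_power intro!: sum.neutral coeff_eq_0)

text \<open>By induction the coefficients of the sum over the vertex links are symmetric. They
  combine consecutive coefficients of \<open>h\<close>, so symmetry spreads from the pair
  \<open>h 0 = h d = 1\<close>, whose first member is the Euler condition at the empty face.\<close>

lemma dehn_sommerville:
  assumes "euler_flag d \<Delta>" "k \<le> d"
  shows "coeff (hpoly d \<Delta>) k = coeff (hpoly d \<Delta>) (d - k)"
  using assms
proof (induction d arbitrary: \<Delta> k)
  case 0
  then show ?case by simp
next
  case (Suc n)
  have \<Delta>: "simplicial_complex \<Delta>" using euler_flagD(1)[OF Suc.prems(1)] .
  note cD = simplicial_complexD[OF \<Delta>]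
  have le: "card F \<le> Suc n" if "F \<in> \<Delta>" for F
    using euler_flag_card_le[OF Suc.prems(1) that] .
  define h where "h = coeff (hpoly (Suc n) \<Delta>)"
  define s where "s j = coeff (\<Sum>v\<in>verts \<Delta>. hpoly n (lk \<Delta> {v})) j" for j
  have s: "s j = (int (Suc n) - int j) * h j + (int j + 1) * h (Suc j)" for j
  proof -
    have "(\<Sum>v\<in>verts \<Delta>. hpoly n (lk \<Delta> {v})) =
      of_nat (Suc n) * hpoly (Suc n) \<Delta> + [:1, - 1:] * pderiv (hpoly (Suc n) \<Delta>)"
      using \<Delta> le by (rule sum_hpoly_links)
    then show ?thesis
      unfolding s_def h_def
      by (cases j) (auto simp: of_nat_poly coeff_pderiv algebra_simps)
  qed
  have s_sym: "s j = s (n - j)" if "j \<le> n" for j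
  proof -
    have "euler_flag n (lk \<Delta> {v})" if "v \<in> verts \<Delta>" for v
      using euler_flag_link[OF Suc.prems(1), of "{v}"] that verts_iff[OF \<Delta>] by simp
    then show ?thesis
      unfolding s_def coeff_sum by (intro sum.cong refl Suc.IH that)
  qed
  have h0: "h 0 = 1"
  proof -
    have "h 0 = (\<Sum>F\<in>\<Delta>. (- 1) ^ (Suc n - card F))"
      by (simp add: h_def hpoly_def coeff_sum coeff_0_power)
    also have "\<dots> = (\<Sum>F\<in>\<Delta>. (- 1) ^ Suc n * (- 1) ^ card F)"
    proof (rule sum.cong[OF refl])
      fix F assume "F \<in> \<Delta>"
      then obtain m where "Suc n = card F + m" using le le_Suc_ex by blast
      then show "(- 1 :: int) ^ (Suc n - card F) = (- 1) ^ Suc n * (- 1) ^ card F"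
        by (simp only: power_add) (simp add: power_mult_distrib[symmetric])
    qed
    also have "\<dots> = (- 1) ^ Suc n * (\<Sum>F\<in>\<Delta>. (- 1) ^ card F)"
      by (simp only: sum_distrib_left)
    also have "(\<Sum>F\<in>\<Delta>. (- 1) ^ card F :: int) = (- 1) ^ Suc n"
      using euler_flagD(4)[OF Suc.prems(1) cD(3)] by simp
    finally show ?thesis by (simp add: power_mult_distrib[symmetric])
  qed
  have hd: "h (Suc n) = 1"
  proof -
    have "h (Suc n) = (\<Sum>F\<in>\<Delta>. if F = {} then 1 else 0)"
      unfolding h_def hpoly_def coeff_sum
    proof (rule sum.cong[OF refl])
      fix F assume F: "F \<in> \<Delta>"
      show "coeff ([:- 1, 1:] ^ (Suc n - card F)) (Suc n) = (if F = {} then 1 else 0 :: int)"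
      proof (cases "F = {}")
        case True
        then show ?thesis by (simp only: True) (simp add: coeff_linear_poly_power del: power_Suc)
      next
        case False
        then have "card F > 0" using F cD(2) by (simp add: card_gt_0_iff)
        then have "degree ([:- 1, 1 :: int:] ^ (Suc n - card F)) < Suc n"
          by (simp only: degree_linear_power)
        then show ?thesis using False by (simp add: coeff_eq_0)
      qed
    qed
    then show ?thesis using cD(1,3) by simp
  qed
  have "h k = h (Suc n - k)" if "k \<le> Suc n" for k
    using that
  proof (induction k)
    case 0
    then show ?case by (simp add: h0 hd)
  next
    case (Suc k)
    have eq: "Suc n - k = Suc (n - k)" using Suc.prems by simp
    have i: "int (n - k) = int n - int k" using Suc.prems by simp
    \<comment> \<open>This is the symmetry of \<open>s\<close> at \<open>k\<close> and
      \<open>n - k\<close>; the terms with factor \<open>Suc n - k\<close> agree by the inner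
      induction hypothesis.\<close>
    have "(int (Suc n) - int k) * h k + (int k + 1) * h (Suc k) =
        (int k + 1) * h (n - k) + (int (Suc n) - int k) * h (Suc (n - k))"
      using s_sym[of k] Suc.prems s[of k] s[of "n - k"] i by (simp add: algebra_simps)
    moreover have "h k = h (Suc (n - k))" using Suc.IH Suc.prems eq by simp
    ultimately have "(int k + 1) * h (Suc k) = (int k + 1) * h (n - k)" by simp
    moreover have "int k + 1 \<noteq> 0" by simp
    ultimately have "h (Suc k) = h (n - k)" by (metis mult_left_cancel)
    then show ?case by simp
  qed
  from this[OF Suc.prems(2)] show ?case unfolding h_def .
qed

section \<open>The gamma vector and its recurrence\<close>

lemma gamma_vector_eqI:
  assumes "h_polynomial d \<Delta> = p" "gamma_expansion d p \<gamma>"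
  shows "gamma_vector d \<Delta> = \<gamma>"
proof -
  have "gamma_vector d \<Delta> = (THE \<gamma>. gamma_expansion d p \<gamma>)"
    unfolding gamma_vector_def gamma_expansion_def assms(1) ..
  also have "\<dots> = \<gamma>"
    by (rule the_equality[where P = "gamma_expansion d p", OF assms(2)])
      (rule gamma_expansion_unique[OF _ assms(2)])
  finally show ?thesis .
qed

lemma gamma_vector_expansion:
  assumes E: "euler_flag d \<Delta>"
  shows "gamma_expansion d (hpoly d \<Delta>) (gamma_vector d \<Delta>)"
proof -
  have "h_polynomial d \<Delta> = hpoly d \<Delta>"
    using simplicial_complexD(1)[OF euler_flagD(1)[OF E]] euler_flag_card_le[OF E]
    by (rule h_polynomial_eq_hpoly)
  moreover obtain \<gamma> where "gamma_expansion d (hpoly d \<Delta>) \<gamma>"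
    using gamma_expansion_exists[of d "hpoly d \<Delta>"] coeff_hpoly_gt dehn_sommerville[OF E] by blast
  ultimately show ?thesis
    using gamma_vector_eqI by metis
qed

text \<open>The operator of \<open>sum_hpoly_links\<close> on a basis element with
  \<open>d = 2 * i + e\<close>: the result has two terms, both basis elements for
  \<open>d - 1\<close>. The truncated exponents at \<open>i = 0\<close> and \<open>e = 0\<close> are
  harmless, as their factors vanish.\<close>

lemma gamma_basis_derivation:
  fixes Z W :: "int poly"
  defines "Z \<equiv> [:0, 1:]" and "W \<equiv> [:1, 1:]"
  shows "of_nat (2 * i + e) * (Z ^ i * W ^ e) + [:1, - 1:] * pderiv (Z ^ i * W ^ e) =
    of_nat i * Z ^ (i - 1) * W ^ (e + 1) + 2 * of_nat e * Z ^ i * W ^ (e - 1)"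
proof -
  have W: "W = 1 + Z" and Y: "[:1, - 1:] = 1 - Z"
    by (simp_all add: Z_def W_def one_pCons)
  have dZ: "pderiv Z = 1" and dW: "pderiv W = 1"
    by (simp_all add: Z_def W_def pderiv_pCons one_pCons)
  have pZ: "pderiv (Z ^ i) = of_nat i * Z ^ (i - 1)" for i
    by (simp add: pderiv_power dZ of_nat_poly)
  have pW: "pderiv (W ^ i) = of_nat i * W ^ (i - 1)" for i
    by (simp add: pderiv_power dW of_nat_poly)
  show ?thesis
    unfolding pderiv_mult pZ pW Y
    by (cases i; cases e) (simp_all add: W algebra_simps)
qed

lemma gamma_expansion_derivation:
  assumes "gamma_expansion (Suc n) p \<gamma>"
  shows "gamma_expansion n (of_nat (Suc n) * p + [:1, - 1:] * pderiv p)
    (\<lambda>j. if j \<le> n div 2 then (int j + 1) * \<gamma> (Suc j) + 2 * (int (Suc n) - 2 * int j) * \<gamma> j else 0)"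
    (is "gamma_expansion n ?q ?\<delta>")
proof -
  let ?Z = "[:0, 1 :: int:]" and ?W = "[:1, 1 :: int:]"
  define N where "N = Suc n div 2"
  \<comment> \<open>\<open>A\<close> holds the terms that move from index \<open>i\<close> to
    \<open>i - 1\<close>, and \<open>B\<close> those that stay at index \<open>i\<close>.\<close>
  define A where "A i = of_int (int i * \<gamma> i) * ?Z ^ (i - 1) * ?W ^ (Suc n - 2 * i + 1)" for i
  define B where "B i = of_int (2 * (int (Suc n) - 2 * int i) * \<gamma> i) * ?Z ^ i * ?W ^ (Suc n - 2 * i - 1)" for i
  have p: "p = (\<Sum>i\<le>N. of_int (\<gamma> i) * (?Z ^ i * ?W ^ (Suc n - 2 * i)))" and z: "\<And>j. j > N \<Longrightarrow> \<gamma> j = 0"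
    using assms by (simp_all add: gamma_expansion_def N_def mult.assoc)
  have "?q = (\<Sum>i\<le>N. of_int (\<gamma> i) * (of_nat (Suc n) * (?Z ^ i * ?W ^ (Suc n - 2 * i))
      + [:1, - 1:] * pderiv (?Z ^ i * ?W ^ (Suc n - 2 * i))))"
  proof -
    have "pderiv (of_int c * q) = of_int c * pderiv q" for c :: int and q :: "int poly"
      by (simp add: of_int_poly pderiv_smult)
    then show ?thesis
      unfolding p by (simp only: pderiv_sum sum_distrib_left sum.distrib distrib_left mult.left_commute)
  qed
  also have "\<dots> = (\<Sum>i\<le>N. A i + B i)"
  proof (rule sum.cong[OF refl])
    fix i assume "i \<in> {..N}"
    then have i: "2 * i \<le> Suc n" by (auto simp: N_def)
    then obtain e where e: "Suc n = 2 * i + e" using le_Suc_ex by blast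
    show "of_int (\<gamma> i) * (of_nat (Suc n) * (?Z ^ i * ?W ^ (Suc n - 2 * i))
      + [:1, - 1:] * pderiv (?Z ^ i * ?W ^ (Suc n - 2 * i))) = A i + B i"
      unfolding A_def B_def e using gamma_basis_derivation[of i e] by (simp add: algebra_simps)
  qed
  also have "\<dots> = sum A {..N} + sum B {..N}" by (rule sum.distrib)
  also have "sum A {..N} = (\<Sum>j\<le>n div 2. A (Suc j))"
  proof -
    have "A 0 = 0" by (simp add: A_def)
    then have "sum A {..N} = (\<Sum>j<N. A (Suc j))"
      by (simp add: sum.atMost_shift)
    also have "\<dots> = (\<Sum>j\<le>n div 2. A (Suc j))"
      by (rule sum.mono_neutral_left) (auto simp: N_def A_def z)
    finally show ?thesis .
  qed
  also have "sum B {..N} = sum B {..n div 2}"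
  proof (rule sum.mono_neutral_right)
    \<comment> \<open>The ranges differ only for even \<open>Suc n\<close>, by the index
      \<open>Suc n div 2\<close>, where the factor \<open>Suc n - 2 * i\<close> is
      \<open>0\<close>.\<close>
    show "\<forall>i\<in>{..N} - {..n div 2}. B i = 0"
    proof
      fix i assume "i \<in> {..N} - {..n div 2}"
      then have "2 * i = Suc n" unfolding N_def by auto
      then have "int (Suc n) - 2 * int i = 0" by linarith
      then show "B i = 0" by (simp add: B_def)
    qed
  qed (auto simp: N_def div_le_mono)
  also have "(\<Sum>j\<le>n div 2. A (Suc j)) + sum B {..n div 2} =
      (\<Sum>j\<le>n div 2. of_int (?\<delta> j) * ?Z ^ j * ?W ^ (n - 2 * j))"
    unfolding sum.distrib[symmetric]
  proof (rule sum.cong[OF refl])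
    fix j assume "j \<in> {..n div 2}"
    then have j: "2 * j \<le> n" by auto
    have "A (Suc j) = of_int ((int j + 1) * \<gamma> (Suc j)) * ?Z ^ j * ?W ^ (n - 2 * j)"
    proof (cases "2 * Suc j \<le> Suc n")
      case True
      then have "Suc n - 2 * Suc j + 1 = n - 2 * j" by simp
      then show ?thesis by (simp add: A_def add.commute)
    next
      case False
      then have "\<gamma> (Suc j) = 0" by (intro z) (auto simp: N_def)
      then show ?thesis by (simp add: A_def)
    qed
    moreover have "B j = of_int (2 * (int (Suc n) - 2 * int j) * \<gamma> j) * ?Z ^ j * ?W ^ (n - 2 * j)"
    proof -
      have "Suc n - 2 * j - 1 = n - 2 * j" by simp
      then show ?thesis by (simp only: B_def)
    qed
    ultimately show "A (Suc j) + B j = of_int (?\<delta> j) * ?Z ^ j * ?W ^ (n - 2 * j)"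
      using j by (simp add: algebra_simps)
  qed
  finally show ?thesis by (simp add: gamma_expansion_def)
qed

lemma gamma_expansion_sum:
  assumes "finite I" "\<And>i. i \<in> I \<Longrightarrow> gamma_expansion d (p i) (\<gamma> i)"
  shows "gamma_expansion d (\<Sum>i\<in>I. p i) (\<lambda>j. \<Sum>i\<in>I. \<gamma> i j)"
proof -
  have "(\<Sum>i\<in>I. p i) = (\<Sum>i\<in>I. \<Sum>j\<le>d div 2. of_int (\<gamma> i j) * [:0, 1:] ^ j * [:1, 1:] ^ (d - 2 * j))"
    using assms(2) by (intro sum.cong) (auto simp: gamma_expansion_def)
  also have "\<dots> = (\<Sum>j\<le>d div 2. of_int (\<Sum>i\<in>I. \<gamma> i j) * [:0, 1:] ^ j * [:1, 1:] ^ (d - 2 * j))"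
    by (subst sum.swap) (simp add: sum_distrib_right)
  finally show ?thesis
    using assms(2) by (auto simp: gamma_expansion_def intro!: sum.neutral)
qed

lemma sum_gamma_vector_links:
  assumes E: "euler_flag (Suc n) \<Delta>" and j: "j \<le> n div 2"
  shows "(\<Sum>v\<in>verts \<Delta>. gamma_vector n (lk \<Delta> {v}) j) =
    (int j + 1) * gamma_vector (Suc n) \<Delta> (Suc j) + 2 * (int (Suc n) - 2 * int j) * gamma_vector (Suc n) \<Delta> j"
proof -
  have \<Delta>: "simplicial_complex \<Delta>" using euler_flagD(1)[OF E] .
  have "euler_flag n (lk \<Delta> {v})" if "v \<in> verts \<Delta>" for v
    using euler_flag_link[OF E, of "{v}"] that verts_iff[OF \<Delta>] by simp
  then have "gamma_expansion n (\<Sum>v\<in>verts \<Delta>. hpoly n (lk \<Delta> {v}))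
      (\<lambda>j. \<Sum>v\<in>verts \<Delta>. gamma_vector n (lk \<Delta> {v}) j)"
    using finite_verts[OF \<Delta>] gamma_vector_expansion by (intro gamma_expansion_sum) auto
  also have "(\<Sum>v\<in>verts \<Delta>. hpoly n (lk \<Delta> {v})) =
      of_nat (Suc n) * hpoly (Suc n) \<Delta> + [:1, - 1:] * pderiv (hpoly (Suc n) \<Delta>)"
    using \<Delta> euler_flag_card_le[OF E] by (rule sum_hpoly_links)
  finally have "(\<lambda>j. \<Sum>v\<in>verts \<Delta>. gamma_vector n (lk \<Delta> {v}) j) =
      (\<lambda>j. if j \<le> n div 2 then (int j + 1) * gamma_vector (Suc n) \<Delta> (Suc j) +
        2 * (int (Suc n) - 2 * int j) * gamma_vector (Suc n) \<Delta> j else 0)"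
    using gamma_expansion_derivation[OF gamma_vector_expansion[OF E]] by (rule gamma_expansion_unique)
  from fun_cong[OF this, of j] show ?thesis
    using j by (simp only: if_True)
qed

text \<open>At \<open>-1\<close> every positive power of \<open>1 + z\<close> vanishes, so only a
  term with \<open>d - 2 * i = 0\<close> survives.\<close>

lemma hpoly_at_minus_1:
  assumes "gamma_expansion d p \<gamma>"
  shows "poly p (- 1) = (if even d then \<gamma> (d div 2) * (- 1) ^ (d div 2) else 0)"
proof -
  have "poly p (- 1) = (\<Sum>i\<le>d div 2. \<gamma> i * (- 1) ^ i * 0 ^ (d - 2 * i))"
    using assms by (simp add: gamma_expansion_def poly_sum poly_power of_int_poly mult.assoc)
  also have "\<dots> = (\<Sum>i\<le>d div 2. if i = d div 2 then (if even d then \<gamma> (d div 2) * (- 1) ^ (d div 2) else 0) else 0)"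
    by (intro sum.cong) (auto simp: power_0_left elim!: evenE)
  finally show ?thesis by simp
qed

section \<open>The top gamma coefficient\<close>

text \<open>Equal to \<open>h(-1) / (-2)^d\<close>. In this normalization the weight of a face does
  not depend on \<open>d\<close>, so links of different dimensions can be added up.\<close>

definition half_weight :: "'a set set \<Rightarrow> rat" where
  "half_weight \<Delta> = (\<Sum>F\<in>\<Delta>. (- 1 / 2) ^ card F)"

lemma half_weight_eq:
  assumes E: "euler_flag d \<Delta>"
  shows "half_weight \<Delta> =
    (if even d then of_int (gamma_vector d \<Delta> (d div 2)) * (- 1) ^ (d div 2) / 2 ^ d else 0)"
proof -
  have "of_int (poly (hpoly d \<Delta>) (- 1)) = (\<Sum>F\<in>\<Delta>. (- 2 :: rat) ^ (d - card F))"
    by (simp add: hpoly_def poly_sum poly_power)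
  also have "\<dots> = (\<Sum>F\<in>\<Delta>. (- 2) ^ d * (- 1 / 2) ^ card F)"
  proof (rule sum.cong[OF refl])
    fix F assume "F \<in> \<Delta>"
    then obtain m where m: "d = card F + m" using euler_flag_card_le[OF E] le_Suc_ex by blast
    have "(- 2 :: rat) ^ card F * (- 1 / 2) ^ card F = 1"
      by (simp add: power_mult_distrib[symmetric])
    then show "(- 2 :: rat) ^ (d - card F) = (- 2) ^ d * (- 1 / 2) ^ card F"
      by (simp add: m power_add mult_ac)
  qed
  also have "\<dots> = (- 2) ^ d * half_weight \<Delta>"
    by (simp add: half_weight_def sum_distrib_left)
  finally have "(- 2) ^ d * half_weight \<Delta> = of_int (poly (hpoly d \<Delta>) (- 1))" by simp
  then show ?thesis
    unfolding hpoly_at_minus_1[OF gamma_vector_expansion[OF E]]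
    by (auto simp: field_simps split: if_splits)
qed

text \<open>Inclusion-exclusion: writing \<open>K\<close> for the union of \<open>F\<close> and a
  face of its link, the weight becomes \<open>(-1)^|F| (-1/2)^|K|\<close>. Summing over the subsets
  \<open>F\<close> of \<open>K \<inter> U\<close> leaves only the \<open>K\<close> disjoint from
  \<open>U\<close>.\<close>

lemma sum_half_weight_links:
  assumes \<Delta>: "simplicial_complex \<Delta>"
  shows "(\<Sum>F\<in>{F\<in>\<Delta>. F \<subseteq> U}. (1 / 2) ^ card F * half_weight (lk \<Delta> F)) =
    (\<Sum>K\<in>{K\<in>\<Delta>. K \<inter> U = {}}. (- 1 / 2) ^ card K)"
proof -
  note cD = simplicial_complexD[OF \<Delta>]
  let ?A = "{F\<in>\<Delta>. F \<subseteq> U}"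
  have "(1 / 2) ^ card F * half_weight (lk \<Delta> F) =
      (\<Sum>K\<in>{K\<in>\<Delta>. F \<subseteq> K}. (- 1) ^ card F * (- 1 / 2) ^ card K)" if F: "F \<in> ?A" for F
    unfolding half_weight_def sum_distrib_left
  proof (rule sum.reindex_bij_witness[of _ "\<lambda>K. K - F" "\<lambda>G. G \<union> F"])
    fix K assume "K \<in> {K\<in>\<Delta>. F \<subseteq> K}"
    then have K: "K \<in> \<Delta>" "K - F \<union> F = K" by auto
    then show "K - F \<union> F = K" "K - F \<in> lk \<Delta> F"
      using cD(4)[OF K(1), of "K - F"] by (auto simp: simplicial_link_def)
  next
    fix G assume G: "G \<in> lk \<Delta> F"
    then show "G \<union> F - F = G" "G \<union> F \<in> {K\<in>\<Delta>. F \<subseteq> K}" by (auto simp: simplicial_link_def)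
    have "card (G \<union> F) = card G + card F"
      using G F cD(2) by (intro card_Un_disjoint) (auto simp: simplicial_link_def)
    moreover have "(- 1 :: rat) ^ card F * (- 1 / 2) ^ card F = (1 / 2) ^ card F"
      by (simp add: power_mult_distrib[symmetric])
    ultimately show "(- 1 :: rat) ^ card F * (- 1 / 2) ^ card (G \<union> F) = (1 / 2) ^ card F * (- 1 / 2) ^ card G"
      by (simp add: power_add mult_ac)
  qed
  then have "(\<Sum>F\<in>?A. (1 / 2) ^ card F * half_weight (lk \<Delta> F)) =
      (\<Sum>F\<in>?A. \<Sum>K\<in>{K\<in>\<Delta>. F \<subseteq> K}. (- 1) ^ card F * (- 1 / 2) ^ card K)"
    by (intro sum.cong) auto
  also have "\<dots> = (\<Sum>K\<in>\<Delta>. \<Sum>F\<in>{F\<in>?A. F \<subseteq> K}. (- 1) ^ card F * (- 1 / 2) ^ card K)"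
    using cD(1) by (intro sum.swap_restrict) auto
  also have "\<dots> = (\<Sum>K\<in>\<Delta>. if K \<inter> U = {} then (- 1 / 2) ^ card K else 0)"
  proof (rule sum.cong[OF refl])
    fix K assume K: "K \<in> \<Delta>"
    have "{F\<in>?A. F \<subseteq> K} = Pow (K \<inter> U)"
      using cD(4)[OF K] by auto
    moreover have "(\<Sum>F\<in>Pow (K \<inter> U). (- 1 :: rat) ^ card F) = 0" if "u \<in> K \<inter> U" for u
      using sum_cone[of "Pow (K \<inter> U)" u "- 1 :: rat"] cD(2)[OF K] that
      by (auto dest: finite_subset)
    ultimately have "(\<Sum>F\<in>{F\<in>?A. F \<subseteq> K}. (- 1 :: rat) ^ card F) = (if K \<inter> U = {} then 1 else 0)"
      by (cases "K \<inter> U = {}") (simp, metis all_not_in_conv)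
    then show "(\<Sum>F\<in>{F\<in>?A. F \<subseteq> K}. (- 1 :: rat) ^ card F * (- 1 / 2) ^ card K) =
        (if K \<inter> U = {} then (- 1 / 2) ^ card K else 0)"
      by (simp only: sum_distrib_right[symmetric]) simp
  qed
  also have "\<dots> = (\<Sum>K\<in>{K\<in>\<Delta>. K \<inter> U = {}}. (- 1 / 2) ^ card K)"
    using cD(1) by (rule sum.inter_filter[symmetric])
  finally show ?thesis .
qed

text \<open>By flagness the link of a vertex is the subcomplex induced on its neighbours.\<close>

lemma link_vertex_iff:
  assumes E: "euler_flag d \<Delta>" and v: "v \<in> verts \<Delta>"
  shows "K \<in> lk \<Delta> {v} \<longleftrightarrow> K \<in> \<Delta> \<and> v \<notin> K \<and> K \<inter> nonneighbours \<Delta> v = {}"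
proof -
  note cD = simplicial_complexD[OF euler_flagD(1)[OF E]]
  have "insert v K \<in> \<Delta>" if K: "K \<in> \<Delta>" "K \<inter> nonneighbours \<Delta> v = {}"
  proof (rule euler_flagD(3)[OF E])
    have KV: "K \<subseteq> verts \<Delta>" using K by (auto simp: simplicial_vertices_def)
    then show "insert v K \<subseteq> verts \<Delta>" using v by simp
    have "{u, v} \<in> \<Delta>" if "u \<in> K" "u \<noteq> v" for u
      using K KV that by (auto simp: nonneighbours_def)
    then show "{a, b} \<in> \<Delta>" if "a \<in> insert v K" "b \<in> insert v K" "a \<noteq> b" for a b
      using that cD(4)[OF K(1), of "{a, b}"] by (auto simp: insert_commute)
  qed
  moreover have "K \<inter> nonneighbours \<Delta> v = {}" if "insert v K \<in> \<Delta>"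
  proof -
    have "{u, v} \<in> \<Delta>" if "u \<in> K" for u
      using cD(4)[OF \<open>insert v K \<in> \<Delta>\<close>, of "{u, v}"] that by simp
    then show ?thesis by (auto simp: nonneighbours_def)
  qed
  moreover have "K \<in> lk \<Delta> {v} \<longleftrightarrow> K \<in> \<Delta> \<and> v \<notin> K \<and> insert v K \<in> \<Delta>"
    by (simp add: simplicial_link_def)
  ultimately show ?thesis by blast
qed

text \<open>The faces avoiding the non-neighbours of \<open>v\<close> form the star of \<open>v\<close>, a cone over an
  even-dimensional sphere, whose weight is half of the weight \<open>0\<close> of its base.\<close>

lemma sum_half_weight_nonneighbours:
  assumes E: "euler_flag d \<Delta>" and "even d" and v: "v \<in> verts \<Delta>"
  shows "(\<Sum>F\<in>{F\<in>\<Delta>. F \<subseteq> nonneighbours \<Delta> v}. (1 / 2) ^ card F * half_weight (lk \<Delta> F)) = 0"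
proof -
  have \<Delta>: "simplicial_complex \<Delta>" using euler_flagD(1)[OF E] .
  note cD = simplicial_complexD[OF \<Delta>]
  let ?U = "nonneighbours \<Delta> v"
  let ?S = "{K\<in>\<Delta>. K \<inter> ?U = {}}"
  have v1: "{v} \<in> \<Delta>" using v verts_iff[OF \<Delta>] by simp
  then have "d \<ge> 1" using euler_flag_card_le[OF E v1] by simp
  then have "odd (d - card {v})" using \<open>even d\<close> by simp
  then have L0: "half_weight (lk \<Delta> {v}) = 0"
    using half_weight_eq[OF euler_flag_link[OF E v1]] by simp
  have "insert v K \<in> ?S" if K: "K \<in> ?S" for K
  proof (cases "v \<in> K")
    case False
    then have "insert v K \<in> \<Delta>"
      using link_vertex_iff[OF E v, of K] K by (auto simp: simplicial_link_def)
    then show ?thesis using K by (auto simp: nonneighbours_def)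
  qed (use K in \<open>simp add: insert_absorb\<close>)
  moreover have "K - {v} \<in> ?S" if K: "K \<in> ?S" for K
    using K cD(4)[of K "K - {v}"] by auto
  ultimately have "(\<Sum>K\<in>?S. (- 1 / 2 :: rat) ^ card K) =
      (1 + - 1 / 2) * (\<Sum>K\<in>{K\<in>?S. v \<notin> K}. (- 1 / 2) ^ card K)"
    using cD(1,2) by (intro sum_cone) auto
  also have "{K\<in>?S. v \<notin> K} = lk \<Delta> {v}"
    using link_vertex_iff[OF E v] by auto
  finally show ?thesis
    using sum_half_weight_links[OF \<Delta>, of ?U] L0 by (simp add: half_weight_def)
qed

text \<open>In the weighted sum over the faces in \<open>U\<close>, the empty face contributes
  \<open>half_weight \<Delta>\<close>. Odd faces drop out, since \<open>d - card F\<close> is then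
  odd and the link has weight \<open>0\<close>.\<close>

lemma top_gamma_zero:
  assumes E: "euler_flag d \<Delta>" and d: "even d" and v: "v \<in> verts \<Delta>"
    and zero: "\<And>F. F \<in> \<Delta> \<Longrightarrow> F \<subseteq> nonneighbours \<Delta> v \<Longrightarrow> F \<noteq> {} \<Longrightarrow> even (card F) \<Longrightarrow>
      gamma_vector (d - card F) (lk \<Delta> F) ((d - card F) div 2) = 0"
  shows "gamma_vector d \<Delta> (d div 2) = 0"
proof -
  note cD = simplicial_complexD[OF euler_flagD(1)[OF E]]
  let ?A = "{F\<in>\<Delta>. F \<subseteq> nonneighbours \<Delta> v}"
  have 0: "half_weight (lk \<Delta> F) = 0" if F: "F \<in> ?A - {{}}" for F
  proof -
    have "card F \<le> d" using F euler_flag_card_le[OF E] by simp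
    then have "even (d - card F) \<longleftrightarrow> even (card F)" using d by simp
    then show ?thesis
      using half_weight_eq[OF euler_flag_link[OF E, of F]] zero[of F] F by simp
  qed
  have "half_weight \<Delta> = (\<Sum>F\<in>?A. (1 / 2) ^ card F * half_weight (lk \<Delta> F))"
    using cD(1,3) 0 by (subst sum.remove[of _ "{}"]) auto
  also have "\<dots> = 0" by (rule sum_half_weight_nonneighbours[OF E d v])
  finally show ?thesis
    using half_weight_eq[OF E] d by simp
qed

text \<open>Only the empty face and the edge survive, so the weight of \<open>\<Delta>\<close> is
  minus a quarter of that of the link. The minus sign and the factor \<open>1/4\<close> are exactly
  the change of \<open>(-1)^(d/2) / 2^d\<close> from \<open>d - 2\<close> to
  \<open>d\<close>.\<close>

lemma top_gamma_edge:
  assumes E: "euler_flag d \<Delta>" and d: "even d" and v: "v \<in> verts \<Delta>"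
    and U: "nonneighbours \<Delta> v = {a, b}" "a \<noteq> b" and ab: "{a, b} \<in> \<Delta>"
  shows "gamma_vector d \<Delta> (d div 2) = gamma_vector (d - 2) (lk \<Delta> {a, b}) ((d - 2) div 2)"
proof -
  note cD = simplicial_complexD[OF euler_flagD(1)[OF E]]
  have d2: "d \<ge> 2" using euler_flag_card_le[OF E ab] U by simp
  have E2: "euler_flag (d - 2) (lk \<Delta> {a, b})" using euler_flag_link[OF E ab] U by (simp add: numeral_2_eq_2)
  have a: "{a} \<in> \<Delta>" and b: "{b} \<in> \<Delta>" using cD(4)[OF ab] by auto
  have 0: "half_weight (lk \<Delta> {a}) = 0" "half_weight (lk \<Delta> {b}) = 0"
    using half_weight_eq[OF euler_flag_link[OF E a]] half_weight_eq[OF euler_flag_link[OF E b]] d d2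
    by auto
  have "{F\<in>\<Delta>. F \<subseteq> {a, b}} = {{}, {a}, {b}, {a, b}}"
  proof -
    have "{F\<in>\<Delta>. F \<subseteq> {a, b}} = \<Delta> \<inter> Pow {a, b}" by auto
    then show ?thesis
      using a b ab cD(3) by (simp add: Pow_insert insert_commute)
  qed
  then have "half_weight \<Delta> + half_weight (lk \<Delta> {a, b}) / 4 = 0"
    using sum_half_weight_nonneighbours[OF E d v] U 0
    by (simp add: doubleton_eq_iff power2_eq_square)
  moreover have "\<exists>m. d = 2 * m + 2"
    using d d2 by presburger
  then obtain m where m: "d = 2 * m + 2" ..
  ultimately show ?thesis
    using half_weight_eq[OF E] half_weight_eq[OF E2] by (simp add: m mult.commute)
qed

text \<open>Faces of the link gain a factor \<open>z - 1\<close> and their extensions by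
  \<open>v\<close> or \<open>w\<close> a factor \<open>1\<close>, so \<open>h\<close> is multiplied
  by \<open>(z - 1) + 1 + 1 = 1 + z\<close>, which leaves the gamma coefficients unchanged.\<close>

lemma gamma_vector_suspension:
  assumes E: "euler_flag (Suc n) \<Delta>" and v: "v \<in> verts \<Delta>" and U: "nonneighbours \<Delta> v = {w}"
  shows "gamma_vector (Suc n) \<Delta> = gamma_vector n (lk \<Delta> {v})"
proof -
  have \<Delta>: "simplicial_complex \<Delta>" using euler_flagD(1)[OF E] .
  let ?L = "lk \<Delta> {v}"
  let ?\<gamma> = "gamma_vector n ?L"
  have v1: "{v} \<in> \<Delta>" using v verts_iff[OF \<Delta>] by simp
  have EL: "euler_flag n ?L" using euler_flag_link[OF E v1] by simp
  note LD = simplicial_complexD[OF euler_flagD(1)[OF EL]]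
  have w: "w \<noteq> v" using U by (auto simp: nonneighbours_def)
  have vL: "v \<notin> F" and wL: "w \<notin> F" if "F \<in> ?L" for F
    using that link_vertex_iff[OF E v] U by auto
  have split: "\<Delta> = ?L \<union> insert v ` ?L \<union> insert w ` ?L"
    by (subst unique_antipode_suspension[OF E v U]) (auto simp: face_join_def)
  have "hpoly (Suc n) \<Delta> = hpoly (Suc n) (?L \<union> insert v ` ?L \<union> insert w ` ?L)"
    using split by simp
  also have "\<dots> = hpoly (Suc n) ?L + hpoly (Suc n) (insert v ` ?L) + hpoly (Suc n) (insert w ` ?L)"
    unfolding hpoly_def using LD(1) vL wL w
    by (subst sum.union_disjoint; (subst sum.union_disjoint)?) (auto dest: equalityD1)
  also have "hpoly (Suc n) ?L = [:- 1, 1:] * hpoly n ?L"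
    unfolding hpoly_def sum_distrib_left
    by (intro sum.cong) (auto simp: Suc_diff_le dest: euler_flag_card_le[OF EL])
  also have "hpoly (Suc n) (insert x ` ?L) = hpoly n ?L" if "\<And>F. F \<in> ?L \<Longrightarrow> x \<notin> F" for x
  proof -
    have "inj_on (insert x) ?L" using that by (intro inj_onI) (metis Diff_insert_absorb)
    then show ?thesis
      unfolding hpoly_def using that LD(2) by (subst sum.reindex) (auto intro!: sum.cong)
  qed
  from this[OF vL] this[OF wL]
  have "[:- 1, 1:] * hpoly n ?L + hpoly (Suc n) (insert v ` ?L) + hpoly (Suc n) (insert w ` ?L) =
      ([:- 1, 1:] + 1 + 1) * hpoly n ?L"
    by (simp only: distrib_right mult_1)
  also have "[:- 1, 1:] + 1 + 1 = [:1, 1 :: int:]" by (simp add: one_pCons)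
  also have "[:1, 1:] * hpoly n ?L =
      (\<Sum>i\<le>n div 2. of_int (?\<gamma> i) * [:0, 1:] ^ i * [:1, 1:] ^ (Suc n - 2 * i))"
  proof -
    have "[:1, 1:] * hpoly n ?L =
      (\<Sum>i\<le>n div 2. [:1, 1:] * (of_int (?\<gamma> i) * [:0, 1:] ^ i * [:1, 1:] ^ (n - 2 * i)))"
      using gamma_vector_expansion[OF EL] unfolding gamma_expansion_def
      by (metis (no_types, lifting) sum.cong sum_distrib_left)
    also have "\<dots> = (\<Sum>i\<le>n div 2. of_int (?\<gamma> i) * [:0, 1:] ^ i * [:1, 1:] ^ (Suc n - 2 * i))"
    proof (rule sum.cong[OF refl])
      fix i assume "i \<in> {..n div 2}"
      then have "Suc n - 2 * i = Suc (n - 2 * i)" by auto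
      then show "[:1, 1:] * (of_int (?\<gamma> i) * [:0, 1:] ^ i * [:1, 1:] ^ (n - 2 * i)) =
          of_int (?\<gamma> i) * [:0, 1:] ^ i * [:1, 1 :: int:] ^ (Suc n - 2 * i)"
        by (simp only: power_Suc mult_ac)
    qed
    finally show ?thesis .
  qed
  also have "\<dots> = (\<Sum>i\<le>Suc n div 2. of_int (?\<gamma> i) * [:0, 1:] ^ i * [:1, 1:] ^ (Suc n - 2 * i))"
    using gamma_vector_expansion[OF EL]
    by (intro sum.mono_neutral_left) (auto simp: gamma_expansion_def)
  finally have "gamma_expansion (Suc n) (hpoly (Suc n) \<Delta>) ?\<gamma>"
    using gamma_vector_expansion[OF EL] by (auto simp: gamma_expansion_def)
  with gamma_vector_expansion[OF E] show ?thesis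
    by (rule gamma_expansion_unique)
qed

text \<open>The recurrence of \<open>sum_gamma_vector_links\<close>, run downwards.\<close>

lemma gamma_vector_zero_if_links_zero:
  assumes E: "euler_flag (Suc n) \<Delta>"
    and links: "\<And>v j. v \<in> verts \<Delta> \<Longrightarrow> j \<ge> l \<Longrightarrow> gamma_vector n (lk \<Delta> {v}) j = 0"
    and top: "even (Suc n) \<Longrightarrow> gamma_vector (Suc n) \<Delta> (Suc n div 2) = 0"
    and "j \<ge> l"
  shows "gamma_vector (Suc n) \<Delta> j = 0"
  using \<open>j \<ge> l\<close>
proof (induction "Suc n - j" arbitrary: j rule: less_induct)
  case less
  \<comment> \<open>In the first case the recurrence has the nonzero factor
    \<open>Suc n - 2 * j\<close>; in the last this factor would be \<open>0\<close>, so the value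
    has to come from \<open>top\<close>.\<close>
  have "j \<le> n div 2 \<or> j > Suc n div 2 \<or> (even (Suc n) \<and> j = Suc n div 2)"
    by presburger
  then consider "j \<le> n div 2" | "j > Suc n div 2" | "even (Suc n)" "j = Suc n div 2"
    by blast
  then show ?case
  proof cases
    case 1
    then have "gamma_vector (Suc n) \<Delta> (Suc j) = 0"
      using less by (intro less.hyps) auto
    moreover have "(\<Sum>v\<in>verts \<Delta>. gamma_vector n (lk \<Delta> {v}) j) = 0"
      using links less.prems by simp
    ultimately have "2 * (int (Suc n) - 2 * int j) * gamma_vector (Suc n) \<Delta> j = 0"
      using sum_gamma_vector_links[OF E 1] by simp
    moreover have "int (Suc n) - 2 * int j \<noteq> 0" using 1 by linarith
    ultimately show ?thesis by simp
  next
    case 2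
    then show ?thesis using gamma_vector_expansion[OF E] by (simp add: gamma_expansion_def)
  next
    case 3
    then show ?thesis using top by simp
  qed
qed

section \<open>Pentagons and joins\<close>

text \<open>The Euler condition reads \<open>1 - n = -1\<close> for \<open>n\<close> vertices. For
  vertex links in a one-dimensional complex it says that every degree is \<open>2\<close>.\<close>

lemma card_verts_euler_flag_1:
  assumes E: "euler_flag 1 \<Delta>"
  shows "card (verts \<Delta>) = 2"
proof -
  have \<Delta>: "simplicial_complex \<Delta>" using euler_flagD(1)[OF E] .
  note cD = simplicial_complexD[OF \<Delta>]
  have "F = {} \<or> (\<exists>v\<in>verts \<Delta>. F = {v})" if F: "F \<in> \<Delta>" for F
  proof -
    have "card F = 0 \<or> card F = 1" using euler_flag_card_le[OF E F] by auto
    then show ?thesis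
      using F cD(2)[OF F] verts_iff[OF \<Delta>] by (auto simp: card_1_singleton_iff)
  qed
  then have "\<Delta> = insert {} ((\<lambda>v. {v}) ` verts \<Delta>)"
    using cD(3) verts_iff[OF \<Delta>] by auto
  then have "(\<Sum>F\<in>\<Delta>. (- 1) ^ card F :: int) = (\<Sum>F\<in>insert {} ((\<lambda>v. {v}) ` verts \<Delta>). (- 1) ^ card F)"
    by simp
  also have "\<dots> = 1 - int (card (verts \<Delta>))"
    using finite_verts[OF \<Delta>] by (subst sum.insert) (auto simp: sum.reindex)
  finally show ?thesis
    using euler_flagD(4)[OF E cD(3)] by simp
qed

definition cycle5 :: "'a \<Rightarrow> 'a \<Rightarrow> 'a \<Rightarrow> 'a \<Rightarrow> 'a \<Rightarrow> 'a set set" where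
  "cycle5 p q r s t =
    {{}, {p}, {q}, {r}, {s}, {t}, {p, q}, {q, r}, {r, s}, {s, t}, {t, p}}"

lemma verts_cycle5: "verts (cycle5 p q r s t) = {p, q, r, s, t}"
  by (auto simp: cycle5_def simplicial_vertices_def)

text \<open>The excluded pairs are the five diagonals, and any three vertices of a pentagon contain
  one.\<close>

lemma mem_cycle5I:
  assumes "F \<subseteq> {p, q, r, s, t}"
    and "\<not> {p, r} \<subseteq> F" "\<not> {p, s} \<subseteq> F" "\<not> {q, s} \<subseteq> F" "\<not> {q, t} \<subseteq> F" "\<not> {r, t} \<subseteq> F"
  shows "F \<in> cycle5 p q r s t"
proof -
  have "F = (if p \<in> F then {p} else {}) \<union> (if q \<in> F then {q} else {}) \<union> (if r \<in> F then {r} else {})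
      \<union> (if s \<in> F then {s} else {}) \<union> (if t \<in> F then {t} else {})"
    using assms(1) by auto
  moreover have "\<dots> \<in> cycle5 p q r s t"
    using assms(2-) by (cases "p \<in> F"; cases "q \<in> F"; cases "r \<in> F"; cases "s \<in> F"; cases "t \<in> F")
      (simp_all add: cycle5_def insert_commute)
  ultimately show ?thesis by simp
qed

text \<open>The vertex \<open>a'\<close> is a non-neighbour of \<open>a\<close> in the link of \<open>b\<close>, and \<open>b'\<close> one of \<open>b\<close> in the link
  of \<open>a\<close>. The link of a facet of \<open>lk {a, b}\<close> is a circle through \<open>b'\<close>, \<open>a\<close>, \<open>b\<close>, \<open>a'\<close> and \<open>v\<close>; as \<open>v\<close> is
  adjacent to neither \<open>a\<close> nor \<open>b\<close>, the circle is a pentagon.\<close>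

lemma pentagon_join:
  assumes E: "euler_flag d \<Delta>" and v: "v \<in> verts \<Delta>"
    and U: "nonneighbours \<Delta> v = {a, b}" "a \<noteq> b" and ab: "{a, b} \<in> \<Delta>"
    and card_V: "card (verts \<Delta>) = card (verts (lk \<Delta> {a, b})) + 5"
  obtains a' b' where "distinct [v, a', b, a, b']"
    "{v, a', b, a, b'} \<inter> verts (lk \<Delta> {a, b}) = {}"
    "\<Delta> = face_join (cycle5 v a' b a b') (lk \<Delta> {a, b})"
proof -
  have \<Delta>: "simplicial_complex \<Delta>" using euler_flagD(1)[OF E] .
  note cD = simplicial_complexD[OF \<Delta>]
  define L where "L = lk \<Delta> {a, b}"
  have a: "{a} \<in> \<Delta>" and b: "{b} \<in> \<Delta>" and v1: "{v} \<in> \<Delta>"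
    using cD(4)[OF ab] v verts_iff[OF \<Delta>] by auto
  have va: "{v, a} \<notin> \<Delta>" "v \<noteq> a" and vb: "{v, b} \<notin> \<Delta>" "v \<noteq> b"
    using U by (auto simp: nonneighbours_def insert_commute)
  have flag3: "{x, y, z} \<in> \<Delta>" if "{x, y} \<in> \<Delta>" "{y, z} \<in> \<Delta>" "{x, z} \<in> \<Delta>" for x y z
  proof (rule euler_flagD(3)[OF E])
    show "{x, y, z} \<subseteq> verts \<Delta>" using that by (auto simp: simplicial_vertices_def)
  qed (use that in \<open>auto simp: insert_commute\<close>)
  \<comment> \<open>In the link of \<open>x\<close>, the vertex \<open>y\<close> has a
    non-neighbour; by flagness it is not adjacent to \<open>y\<close> in \<open>\<Delta>\<close>
    either.\<close>
  have antipode: "\<exists>y'. y' \<noteq> x \<and> y' \<noteq> y \<and> {y', x} \<in> \<Delta> \<and> {y', y} \<notin> \<Delta>"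
    if xy: "{x, y} \<in> \<Delta>" "x \<noteq> y" for x y
  proof -
    have x: "{x} \<in> \<Delta>" using cD(4)[OF xy(1)] by auto
    have "y \<in> verts (lk \<Delta> {x})"
      using verts_link_vertex[OF \<Delta> x] xy by (auto simp: insert_commute)
    then obtain y' where y': "y' \<in> verts (lk \<Delta> {x})" "y' \<noteq> y" "{y', y} \<notin> lk \<Delta> {x}"
      using nonneighbours_nonempty[OF euler_flag_link[OF E x]] by (auto simp: nonneighbours_def)
    then have y'x: "y' \<noteq> x" "{y', x} \<in> \<Delta>" using verts_link_vertex[OF \<Delta> x] by auto
    have "{y', y} \<notin> \<Delta>"
    proof
      assume "{y', y} \<in> \<Delta>"
      then have "{y', y, x} \<in> \<Delta>" using flag3[of y' y x] y'x xy by (simp add: insert_commute)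
      then show False
        using y'(3) y'x xy \<open>{y', y} \<in> \<Delta>\<close> by (auto simp: simplicial_link_def insert_commute)
    qed
    then show ?thesis using y' y'x by auto
  qed
  obtain b' where b': "b' \<noteq> a" "b' \<noteq> b" "{b', a} \<in> \<Delta>" "{b', b} \<notin> \<Delta>"
    using antipode[OF ab] U by auto
  obtain a' where a': "a' \<noteq> a" "a' \<noteq> b" "{a', b} \<in> \<Delta>" "{a', a} \<notin> \<Delta>"
    using antipode[of b a] ab U by (auto simp: insert_commute)
  have EL: "euler_flag (d - card {a, b}) L" unfolding L_def by (rule euler_flag_link[OF E ab])
  have LC: "simplicial_complex L" using euler_flagD(1)[OF EL] .
  have L_iff: "g \<in> L \<longleftrightarrow> a \<notin> g \<and> b \<notin> g \<and> insert a (insert b g) \<in> \<Delta>" for g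
    using cD(4)[of "insert a (insert b g)" g] by (auto simp: L_def simplicial_link_def)
  have adj_ab: "{u, a} \<in> \<Delta>" "{u, b} \<in> \<Delta>" "u \<noteq> a" "u \<noteq> b" if "u \<in> verts L" for u
  proof -
    have "{u} \<in> L" using that verts_iff[OF LC] by simp
    then have "insert a (insert b {u}) \<in> \<Delta>" "u \<noteq> a" "u \<noteq> b" by (auto simp: L_iff)
    then show "{u, a} \<in> \<Delta>" "{u, b} \<in> \<Delta>" "u \<noteq> a" "u \<noteq> b" by (auto intro: cD(4))
  qed
  let ?W = "{v, a', b, a, b'}"
  have dist: "distinct [v, a', b, a, b']"
  proof -
    have "v \<noteq> a'" using vb(1) a'(3) by metis
    moreover have "v \<noteq> b'" using va(1) b'(3) by metis
    moreover have "a' \<noteq> b'" using a'(4) b'(3) by metis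
    ultimately show ?thesis
      using va(2) vb(2) a'(1,2) b'(1,2) U(2) by simp
  qed
  have disj: "?W \<inter> verts L = {}"
  proof -
    have "v \<notin> verts L" "b' \<notin> verts L" "a' \<notin> verts L" "a \<notin> verts L" "b \<notin> verts L"
      using adj_ab(1)[of v] adj_ab(2)[of b'] adj_ab(1)[of a'] adj_ab(3)[of a] adj_ab(4)[of b]
        va(1) b'(4) a'(4) by metis+
    then show ?thesis by simp
  qed
  \<comment> \<open>The five vertices of the pentagon are distinct and outside \<open>L\<close>, so
    by \<open>card_V\<close> nothing else is left.\<close>
  have WL: "?W \<union> verts L = verts \<Delta>"
  proof (rule card_subset_eq)
    show "finite (verts \<Delta>)" using finite_verts[OF \<Delta>] .
    show "?W \<union> verts L \<subseteq> verts \<Delta>"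
      using v a b a'(3) b'(3) by (auto simp: simplicial_vertices_def L_def simplicial_link_def)
    have "card ?W = 5" using dist by simp
    then show "card (?W \<union> verts L) = card (verts \<Delta>)"
      using disj finite_verts[OF LC] card_V by (subst card_Un_disjoint) (auto simp: L_def)
  qed
  have adj_v: "{u, v} \<in> \<Delta>" if "u \<in> verts \<Delta>" "u \<noteq> v" "u \<noteq> a" "u \<noteq> b" for u
    using that U by (auto simp: nonneighbours_def)
  have V: "a' \<in> verts \<Delta>" "b' \<in> verts \<Delta>" using WL by auto
  have va': "{a', v} \<in> \<Delta>" and vb': "{b', v} \<in> \<Delta>"
    using adj_v V a' b' dist by auto
  have facet: "{a', b'} \<notin> \<Delta> \<and> insert a' x \<in> \<Delta> \<and> insert b' x \<in> \<Delta>"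
    if x: "x \<in> L" "card x = d - card {a, b}" for x
  proof -
    have xD: "x \<in> \<Delta>" using x by (simp add: L_def simplicial_link_def)
    have d2: "card {a, b} \<le> d" using euler_flag_card_le[OF E ab] .
    define C where "C = lk \<Delta> x"
    have EC: "euler_flag (d - card x) C" unfolding C_def by (rule euler_flag_link[OF E xD])
    have d2': "d - card x = 2" using x(2) d2 U by simp
    have C: "simplicial_complex C" using euler_flagD(1)[OF EC] .
    have xV: "x \<subseteq> verts L" using x by (auto simp: simplicial_vertices_def)
    have flagx: "f \<in> C" if f: "f \<in> \<Delta>" "f \<inter> x = {}" "\<And>p q. p \<in> f \<Longrightarrow> q \<in> x \<Longrightarrow> {p, q} \<in> \<Delta>" for f
    proof -
      have "f \<union> x \<in> \<Delta>"
      proof (rule euler_flagD(3)[OF E])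
        show "f \<union> x \<subseteq> verts \<Delta>" using f xD by (auto simp: simplicial_vertices_def)
        show "{p, q} \<in> \<Delta>" if "p \<in> f \<union> x" "q \<in> f \<union> x" "p \<noteq> q" for p q
          using that f(3)[of p q] f(3)[of q p] cD(4)[OF f(1), of "{p, q}"] cD(4)[OF xD, of "{p, q}"]
          by (auto simp: insert_commute)
      qed
      then show ?thesis using f by (simp add: C_def simplicial_link_def)
    qed
    have adj_x: "{p, q} \<in> \<Delta>" if "p \<in> verts C" "q \<in> x" for p q
    proof -
      have "insert p x \<in> \<Delta>" using that verts_iff[OF C, of p] by (simp add: C_def simplicial_link_def)
      then show ?thesis using that by (auto intro: cD(4))
    qed
    have notx: "p \<notin> x" if "p \<in> verts C" for p
      using that verts_iff[OF C, of p] by (simp add: C_def simplicial_link_def)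
    have CV: "verts C \<subseteq> ?W"
    proof
      fix u assume u: "u \<in> verts C"
      show "u \<in> ?W"
      proof (rule ccontr)
        assume "u \<notin> ?W"
        moreover have "u \<in> verts \<Delta>"
          using u by (auto simp: C_def simplicial_vertices_def simplicial_link_def)
        ultimately have uL: "u \<in> verts L" using WL by auto
        \<comment> \<open>A further vertex of \<open>L\<close> would produce a triangle in the
          one-dimensional complex \<open>C\<close>.\<close>
        have "{a, b, u} \<in> C"
        proof (rule flagx)
          show "{a, b, u} \<in> \<Delta>"
            using flag3[of a b u] ab adj_ab[OF uL] by (simp add: insert_commute)
          show "{a, b, u} \<inter> x = {}" using x(1) notx[OF u] by (auto simp: L_iff)
          show "{p, q} \<in> \<Delta>" if "p \<in> {a, b, u}" "q \<in> x" for p q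
            using that adj_x[OF u] adj_ab[of q] xV by (auto simp: insert_commute)
        qed
        then have "card {a, b, u} \<le> 2" using euler_flag_card_le[OF EC] d2' by auto
        then show False using U adj_ab[OF uL] by auto
      qed
    qed
    have deg: "card {u. u \<noteq> p \<and> {u, p} \<in> C} = 2" if p: "p \<in> verts C" for p
    proof -
      have p1: "{p} \<in> C" using p verts_iff[OF C] by simp
      have "euler_flag 1 (lk C {p})"
        using euler_flag_link[OF EC p1] d2' by simp
      then show ?thesis
        using card_verts_euler_flag_1 verts_link_vertex[OF C p1] by force
    qed
    have edge_vert: "p \<in> verts C" "q \<in> verts C" if "{p, q} \<in> C" for p q
      using that by (auto simp: simplicial_vertices_def)
    have C\<Delta>: "f \<in> \<Delta>" if "f \<in> C" for f using that by (simp add: C_def simplicial_link_def)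
    have vC: "v \<in> verts C"
    proof -
      have "{v} \<in> C"
      proof (rule flagx)
        show "{p, q} \<in> \<Delta>" if "p \<in> {v}" "q \<in> x" for p q
        proof -
          have "q \<in> verts \<Delta>" "q \<noteq> v" "q \<noteq> a" "q \<noteq> b"
            using that xV adj_ab[of q] disj WL by auto
          then show ?thesis using adj_v[of q] that by (simp add: insert_commute)
        qed
      qed (use v1 xV disj in auto)
      then show ?thesis using verts_iff[OF C] by simp
    qed
    \<comment> \<open>As \<open>v\<close> has degree \<open>2\<close> in \<open>C\<close>, this
      inclusion places both \<open>a'\<close> and \<open>b'\<close> in \<open>C\<close>.\<close>
    have "{u. u \<noteq> v \<and> {u, v} \<in> C} \<subseteq> {a', b'}"
    proof
      fix u assume "u \<in> {u. u \<noteq> v \<and> {u, v} \<in> C}"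
      then have u: "u \<noteq> v" "{u, v} \<in> C" by auto
      then have "u \<in> ?W" "u \<noteq> a" "u \<noteq> b"
        using CV edge_vert[OF u(2)] C\<Delta>[OF u(2)] va vb by (auto simp: insert_commute)
      then show "u \<in> {a', b'}" using u by auto
    qed
    moreover have "card {a', b'} = 2" using dist by simp
    ultimately have "{u. u \<noteq> v \<and> {u, v} \<in> C} = {a', b'}"
      using deg[OF vC] by (intro card_subset_eq) auto
    then have a'C: "{a', v} \<in> C" and b'C: "{b', v} \<in> C" by auto
    have a'V: "a' \<in> verts C" and b'V: "b' \<in> verts C"
      using edge_vert[OF a'C] edge_vert[OF b'C] by auto
    \<comment> \<open>Otherwise \<open>a'\<close> would have the three neighbours \<open>v\<close>,
      \<open>b\<close> and \<open>b'\<close> in \<open>C\<close>, against degree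
      \<open>2\<close>.\<close>
    have "{a', b'} \<notin> \<Delta>"
    proof
      assume a'b': "{a', b'} \<in> \<Delta>"
      have "{a', b} \<in> C"
      proof (rule flagx)
        show "{a', b} \<inter> x = {}" using notx[OF a'V] x(1) by (auto simp: L_iff)
        show "{p, q} \<in> \<Delta>" if "p \<in> {a', b}" "q \<in> x" for p q
          using that adj_x[OF a'V, of q] adj_ab(2)[of q] xV by (auto simp: insert_commute)
      qed (use a' in auto)
      moreover have "{a', b'} \<in> C"
      proof (rule flagx)
        show "{a', b'} \<inter> x = {}" using notx[OF a'V] notx[OF b'V] by auto
        show "{p, q} \<in> \<Delta>" if "p \<in> {a', b'}" "q \<in> x" for p q
          using that adj_x[OF a'V] adj_x[OF b'V] by auto
      qed (use a'b' in auto)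
      ultimately have "{v, b, b'} \<subseteq> {u. u \<noteq> a' \<and> {u, a'} \<in> C}"
        using a'C dist by (auto simp: insert_commute)
      moreover have "finite {u. u \<noteq> a' \<and> {u, a'} \<in> C}"
        using deg[OF a'V] by (intro card_ge_0_finite) simp
      ultimately have "card {v, b, b'} \<le> 2"
        using deg[OF a'V] card_mono by metis
      then show False using dist by simp
    qed
    moreover have "insert a' x \<in> \<Delta>" "insert b' x \<in> \<Delta>"
      using a'V b'V verts_iff[OF C] by (auto simp: C_def simplicial_link_def)
    ultimately show ?thesis by simp
  qed
  have a'b': "{a', b'} \<notin> \<Delta>"
    using euler_flagD(2)[OF EL simplicial_complexD(3)[OF LC]] facet by auto
  \<comment> \<open>Every vertex of \<open>L\<close> lies in a facet of \<open>L\<close>, and facets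
    extend by \<open>a'\<close> and by \<open>b'\<close>.\<close>
  have adj_L: "{u, a'} \<in> \<Delta> \<and> {u, b'} \<in> \<Delta>" if u: "u \<in> verts L" for u
  proof -
    have "{u} \<in> L" using u verts_iff[OF LC] by simp
    then obtain x where x: "x \<in> L" "u \<in> x" "card x = d - card {a, b}"
      using euler_flagD(2)[OF EL] by blast
    then have "insert a' x \<in> \<Delta>" "insert b' x \<in> \<Delta>" using facet by auto
    then show ?thesis using x(2) by (auto intro: cD(4))
  qed
  have adj_WL: "{p, u} \<in> \<Delta>" if u: "u \<in> verts L" and p: "p \<in> ?W" for p u
  proof -
    have "u \<in> verts \<Delta>" "u \<noteq> v" using u disj WL by auto
    then show ?thesis
      using p adj_ab[OF u] adj_L[OF u] adj_v[of u] by (auto simp: insert_commute)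
  qed
  have "\<Delta> = face_join (cycle5 v a' b a b') L"
  proof (intro equalityI subsetI)
    fix F assume F: "F \<in> \<Delta>"
    have FV: "F \<subseteq> verts \<Delta>" using F by (auto simp: simplicial_vertices_def)
    have edge: "{p, q} \<in> \<Delta>" if "p \<in> F" "q \<in> F" for p q
      using that by (intro cD(4)[OF F]) auto
    have "F \<inter> ?W \<in> cycle5 v a' b a b'"
      by (rule mem_cycle5I) (use edge va vb a' b' a'b' in \<open>auto simp: insert_commute\<close>)
    moreover have "F \<inter> verts L \<in> L"
    proof -
      have "insert a (insert b (F \<inter> verts L)) \<in> \<Delta>"
      proof (rule euler_flagD(3)[OF E])
        show "insert a (insert b (F \<inter> verts L)) \<subseteq> verts \<Delta>" using WL by auto
        show "{p, q} \<in> \<Delta>" if "p \<in> insert a (insert b (F \<inter> verts L))"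
          "q \<in> insert a (insert b (F \<inter> verts L))" "p \<noteq> q" for p q
          using that edge[of p q] adj_ab(1,2)[of p] adj_ab(1,2)[of q] ab
          by (auto simp: insert_commute)
      qed
      then show ?thesis using adj_ab by (auto simp: L_iff)
    qed
    moreover have "F = (F \<inter> ?W) \<union> (F \<inter> verts L)" using FV WL by auto
    ultimately show "F \<in> face_join (cycle5 v a' b a b') L"
      unfolding face_join_def by blast
  next
    fix F assume "F \<in> face_join (cycle5 v a' b a b') L"
    then obtain f g where F: "F = f \<union> g" "f \<in> cycle5 v a' b a b'" "g \<in> L"
      by (auto simp: face_join_def)
    have fW: "f \<subseteq> ?W" using F(2) verts_cycle5[of v a' b a b'] by (auto simp: simplicial_vertices_def)
    have gV: "g \<subseteq> verts L" using F(3) by (auto simp: simplicial_vertices_def)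
    have f: "f \<in> \<Delta>"
      using F(2) v1 a b verts_iff[OF \<Delta>] V va' vb' ab a' b' cD(3)
      by (auto simp: cycle5_def insert_commute)
    have g: "g \<in> \<Delta>" using F(3) by (simp add: L_def simplicial_link_def)
    show "F \<in> \<Delta>"
      unfolding F(1)
    proof (rule euler_flagD(3)[OF E])
      show "f \<union> g \<subseteq> verts \<Delta>" using fW gV WL by auto
      show "{p, q} \<in> \<Delta>" if "p \<in> f \<union> g" "q \<in> f \<union> g" "p \<noteq> q" for p q
      proof -
        consider "p \<in> f" "q \<in> f" | "p \<in> g" "q \<in> g" | "p \<in> f" "q \<in> g" | "p \<in> g" "q \<in> f"
          using \<open>p \<in> f \<union> g\<close> \<open>q \<in> f \<union> g\<close> by blast
        then show ?thesis
        proof cases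
          case 1 then show ?thesis by (intro cD(4)[OF f]) auto
        next
          case 2 then show ?thesis by (intro cD(4)[OF g]) auto
        next
          case 3 then show ?thesis using fW gV by (intro adj_WL) auto
        next
          case 4
          then have "{q, p} \<in> \<Delta>" using fW gV by (intro adj_WL) auto
          then show ?thesis by (simp add: insert_commute)
        qed
      qed
    qed
  qed
  then show ?thesis
    using that dist disj unfolding L_def by blast
qed

section \<open>Isomorphisms with the model complexes\<close>

lemma simplicial_isomorphic_join:
  assumes A: "simplicial_isomorphic A X" and B: "simplicial_isomorphic B Y"
    and disj: "verts A \<inter> verts B = {}" and ne: "{} \<in> A" "{} \<in> B"
  shows "simplicial_isomorphic (face_join A B) (simplicial_join X Y)"
proof -
  obtain \<alpha> where \<alpha>: "bij_betw \<alpha> (verts A) (verts X)" "(\<lambda>f. \<alpha> ` f) ` A = X"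
    using A by (auto simp: simplicial_isomorphic_def)
  obtain \<beta> where \<beta>: "bij_betw \<beta> (verts B) (verts Y)" "(\<lambda>f. \<beta> ` f) ` B = Y"
    using B by (auto simp: simplicial_isomorphic_def)
  define \<phi> where "\<phi> u = (if u \<in> verts A then sum_encode (Inl (\<alpha> u)) else sum_encode (Inr (\<beta> u)))" for u
  have \<phi>: "\<phi> ` (f \<union> g) = sum_encode ` ((\<alpha> ` f) <+> (\<beta> ` g))" if "f \<in> A" "g \<in> B" for f g
  proof -
    have "f \<subseteq> verts A" "g \<subseteq> verts B" using that by (auto simp: simplicial_vertices_def)
    then have "\<phi> ` f = (\<lambda>u. sum_encode (Inl (\<alpha> u))) ` f" "\<phi> ` g = (\<lambda>u. sum_encode (Inr (\<beta> u))) ` g"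
      using disj by (auto simp: \<phi>_def intro!: image_cong)
    then show ?thesis by (simp add: image_Un Plus_def image_image)
  qed
  have image: "(\<lambda>f. \<phi> ` f) ` face_join A B = simplicial_join X Y"
  proof (intro equalityI subsetI)
    fix h assume "h \<in> (\<lambda>f. \<phi> ` f) ` face_join A B"
    then obtain f g where fg: "f \<in> A" "g \<in> B" "h = \<phi> ` (f \<union> g)"
      by (auto simp: face_join_def)
    then have "\<alpha> ` f \<in> X" "\<beta> ` g \<in> Y" using \<alpha>(2) \<beta>(2) by auto
    then show "h \<in> simplicial_join X Y"
      unfolding simplicial_join_def fg(3) \<phi>[OF fg(1,2)] by blast
  next
    fix h assume "h \<in> simplicial_join X Y"
    then obtain f g where fg: "f \<in> A" "g \<in> B" "h = sum_encode ` ((\<alpha> ` f) <+> (\<beta> ` g))"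
      unfolding simplicial_join_def \<alpha>(2)[symmetric] \<beta>(2)[symmetric] by blast
    then have "h = \<phi> ` (f \<union> g)" "f \<union> g \<in> face_join A B"
      using \<phi> by (auto simp: face_join_def)
    then show "h \<in> (\<lambda>f. \<phi> ` f) ` face_join A B" by (rule image_eqI)
  qed
  have verts: "verts (face_join A B) = verts A \<union> verts B"
    using ne by (auto simp: face_join_def simplicial_vertices_def)
  have "verts (simplicial_join X Y) = \<phi> ` verts (face_join A B)"
    unfolding image[symmetric] simplicial_vertices_def by auto
  moreover have "inj_on \<phi> (verts (face_join A B))"
    using \<alpha>(1) \<beta>(1) unfolding verts inj_on_def bij_betw_def
    by (auto simp: \<phi>_def sum_encode_eq)
  ultimately show ?thesis
    using image by (auto simp: simplicial_isomorphic_def bij_betw_def)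
qed

lemma simplicial_isomorphic_sphere0:
  assumes "v \<noteq> w"
  shows "simplicial_isomorphic {{}, {v}, {w}} sphere0_complex"
proof -
  let ?\<phi> = "\<lambda>u. if u = v then 0 else 1 :: nat"
  have "bij_betw ?\<phi> (verts {{}, {v}, {w}}) (verts sphere0_complex)"
    using assms by (auto simp: bij_betw_def inj_on_def simplicial_vertices_def sphere0_complex_def)
  moreover have "(\<lambda>f. ?\<phi> ` f) ` {{}, {v}, {w}} = sphere0_complex"
    using assms by (auto simp: sphere0_complex_def)
  ultimately show ?thesis unfolding simplicial_isomorphic_def by blast
qed

lemma simplicial_isomorphic_cycle5:
  assumes "distinct [p, q, r, s, t]"
  shows "simplicial_isomorphic (cycle5 p q r s t) pentagon_complex"
proof -
  define \<phi> :: "'a \<Rightarrow> nat" where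
    "\<phi> u = (if u = p then 0 else if u = q then 1 else if u = r then 2 else if u = s then 3 else 4)" for u
  have \<phi>: "\<phi> p = 0" "\<phi> q = 1" "\<phi> r = 2" "\<phi> s = 3" "\<phi> t = 4"
    using assms by (auto simp: \<phi>_def)
  have "verts pentagon_complex = {0, 1, 2, 3, 4}"
    by (auto simp: simplicial_vertices_def pentagon_complex_def)
  then have "bij_betw \<phi> (verts (cycle5 p q r s t)) (verts pentagon_complex)"
    using assms \<phi> by (simp add: bij_betw_def verts_cycle5)
  moreover have "(\<lambda>f. \<phi> ` f) ` cycle5 p q r s t = pentagon_complex"
    by (simp add: cycle5_def pentagon_complex_def \<phi>)
  ultimately show ?thesis unfolding simplicial_isomorphic_def by blast
qed

section \<open>Complexes with few vertices\<close>

abbreviation "model m l \<equiv> (simplicial_suspension ^^ m) (join_power l pentagon_complex)"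

text \<open>The equation \<open>d = m + 2 * l\<close> strengthens the induction: in the pentagon
  case it forces the number of suspensions in the model of the link to be \<open>0\<close>, so the
  join with a new pentagon is a model again.\<close>

lemma gamma_vector_few_vertices:
  assumes "euler_flag d \<Delta>" "card (verts \<Delta>) = 2 * d + l"
  shows "0 \<le> gamma_vector d \<Delta> l \<and> gamma_vector d \<Delta> l \<le> 1 \<and> (\<forall>j>l. gamma_vector d \<Delta> j = 0) \<and>
    (gamma_vector d \<Delta> l = 1 \<longrightarrow> (\<exists>m. d = m + 2 * l \<and> simplicial_isomorphic \<Delta> (model m l)))"
  using assms
proof (induction d arbitrary: \<Delta> l rule: less_induct)
  case (less d)
  note E = less.prems(1)
  let ?\<gamma> = "gamma_vector d \<Delta>"
  have \<Delta>: "simplicial_complex \<Delta>" using euler_flagD(1)[OF E] .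
  note cD = simplicial_complexD[OF \<Delta>]
  have v1: "{v} \<in> \<Delta>" if "v \<in> verts \<Delta>" for v using that verts_iff[OF \<Delta>] by simp
  show ?case
  proof (cases d)
    case 0
    have "F = {}" if "F \<in> \<Delta>" for F
      using euler_flag_card_le[OF E that] cD(2)[OF that] 0 by simp
    then have D: "\<Delta> = {{}}" using cD(3) by auto
    then have l: "l = 0" using less.prems(2) 0 by (simp add: simplicial_vertices_def)
    have "gamma_expansion d (hpoly d \<Delta>) (\<lambda>i. if i = 0 then 1 else 0)"
      by (simp add: gamma_expansion_def hpoly_def D 0)
    then have "?\<gamma> = (\<lambda>i. if i = 0 then 1 else 0)"
      using gamma_vector_expansion[OF E] gamma_expansion_unique by blast
    moreover have "simplicial_isomorphic \<Delta> {{} :: nat set}"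
      by (simp add: simplicial_isomorphic_def D simplicial_vertices_def bij_betw_def)
    ultimately show ?thesis
      using l 0 by (auto intro!: exI[of _ 0])
  next
    case (Suc n)
    have EL: "euler_flag n (lk \<Delta> {v})" if "v \<in> verts \<Delta>" for v
      using euler_flag_link[OF E v1[OF that]] Suc by simp
    have fU: "finite (nonneighbours \<Delta> v)" for v
      using finite_verts[OF \<Delta>] by (simp add: nonneighbours_def)
    show ?thesis
    \<comment> \<open>With a single non-neighbour the complex is a suspension, and the link has the
      same excess and the same gamma vector.\<close>
    proof (cases "\<exists>v\<in>verts \<Delta>. card (nonneighbours \<Delta> v) = 1")
      case True
      then obtain v w where v: "v \<in> verts \<Delta>" and U: "nonneighbours \<Delta> v = {w}"
        by (auto simp: card_1_singleton_iff)
      let ?L = "lk \<Delta> {v}"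
      have vw: "v \<noteq> w" using U by (auto simp: nonneighbours_def)
      have "card (verts ?L) = 2 * n + l"
        using card_verts_vertex[OF \<Delta> v] less.prems(2) U Suc by simp
      note IH = less.IH[OF _ EL[OF v] this]
      have g: "?\<gamma> = gamma_vector n ?L"
        using gamma_vector_suspension[of n \<Delta> v w] E v U Suc by simp
      have "\<exists>m. d = m + 2 * l \<and> simplicial_isomorphic \<Delta> (model m l)" if "gamma_vector n ?L l = 1"
      proof -
        obtain m where m: "n = m + 2 * l" "simplicial_isomorphic ?L (model m l)"
          using IH Suc \<open>gamma_vector n ?L l = 1\<close> by auto
        have "simplicial_isomorphic (face_join {{}, {v}, {w}} ?L) (simplicial_join sphere0_complex (model m l))"
        proof (rule simplicial_isomorphic_join[OF simplicial_isomorphic_sphere0[OF vw] m(2)])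
          show "verts {{}, {v}, {w}} \<inter> verts ?L = {}"
            using link_vertex_iff[OF E v] U by (auto simp: simplicial_vertices_def)
          show "{} \<in> ?L" using v1[OF v] cD(3) by (simp add: simplicial_link_def)
        qed simp
        then have "simplicial_isomorphic \<Delta> (model (Suc m) l)"
          using unique_antipode_suspension[OF E v U] by (simp add: simplicial_suspension_def)
        then show ?thesis using m(1) Suc by (intro exI[of _ "Suc m"]) simp
      qed
      then show ?thesis using IH Suc g by auto
    next
      case False
      have U2: "card (nonneighbours \<Delta> v) \<ge> 2" if v: "v \<in> verts \<Delta>" for v
      proof -
        have "card (nonneighbours \<Delta> v) \<noteq> 0" using nonneighbours_nonempty[OF E v] fU by simp
        moreover have "card (nonneighbours \<Delta> v) \<noteq> 1" using False v by auto
        ultimately show ?thesis by linarith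
      qed
      have links: "gamma_vector n (lk \<Delta> {v}) j = 0" if v: "v \<in> verts \<Delta>" and j: "j \<ge> l" for v j
      proof -
        define l' where "l' = card (verts (lk \<Delta> {v})) - 2 * n"
        have l': "card (verts (lk \<Delta> {v})) = 2 * n + l'"
          using card_verts_ge[OF EL[OF v]] by (simp add: l'_def)
        \<comment> \<open>The vertex and at least two non-neighbours are lost, while
          \<open>2 * d\<close> drops only by \<open>2\<close>.\<close>
        then have "l' < l"
          using card_verts_vertex[OF \<Delta> v] U2[OF v] less.prems(2) Suc by simp
        then show ?thesis using less.IH[OF _ EL[OF v] l'] j Suc by simp
      qed
      have beyond: "?\<gamma> j = 0" if "j > d div 2" for j
        using gamma_vector_expansion[OF E] that by (simp add: gamma_expansion_def)
      \<comment> \<open>If all coefficients from degree \<open>l\<close> on vanish, then the value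
        in degree \<open>l\<close> is \<open>0\<close> and the isomorphism claim is vacuous.\<close>
      have finish: ?thesis if "even d \<Longrightarrow> l \<le> d div 2 \<Longrightarrow> ?\<gamma> (d div 2) = 0"
      proof -
        have "?\<gamma> j = 0" if "j \<ge> l" for j
        proof (cases "even d \<and> l > d div 2")
          case True
          then show ?thesis using that by (intro beyond) simp
        next
          case False
          then show ?thesis
            using gamma_vector_zero_if_links_zero[of n \<Delta> l j] E links that Suc
              \<open>even d \<Longrightarrow> l \<le> d div 2 \<Longrightarrow> ?\<gamma> (d div 2) = 0\<close> by auto
        qed
        then show ?thesis by simp
      qed
      show ?thesis
      proof (cases "even d \<and> l \<le> d div 2")
        case False
        then show ?thesis using finish by blast
      next
        case True
        then have d: "even d" and ld: "l \<le> d div 2" by auto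
        have "verts \<Delta> \<noteq> {}" using less.prems(2) Suc by auto
        let ?N = "\<lambda>v. card (verts (lk \<Delta> {v}))"
        have "Max (?N ` verts \<Delta>) \<in> ?N ` verts \<Delta>"
          using finite_verts[OF \<Delta>] \<open>verts \<Delta> \<noteq> {}\<close> by (intro Max_in) auto
        then obtain v where v: "v \<in> verts \<Delta>" and "Max (?N ` verts \<Delta>) = ?N v" by blast
        then have max: "?N u \<le> ?N v" if "u \<in> verts \<Delta>" for u
          using that finite_verts[OF \<Delta>] by (metis Max_ge finite_imageI imageI)
        let ?U = "nonneighbours \<Delta> v"
        have card_v: "card (verts (lk \<Delta> {v})) + 1 + card ?U = 2 * d + l"
          using card_verts_vertex[OF \<Delta> v] less.prems(2) by simp
        \<comment> \<open>Since \<open>v\<close> has maximal degree, its link bounds that of any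
          vertex of \<open>F\<close>. Its size \<open>2 * d + l - 1 - card ?U\<close> leaves the
          link of \<open>F\<close> an excess of at most \<open>l + 1 - card ?U\<close>.\<close>
        have face: "\<exists>l'. euler_flag (d - card F) (lk \<Delta> F) \<and> card (verts (lk \<Delta> F)) = 2 * (d - card F) + l' \<and>
            l' + card ?U \<le> l + 1 \<and> card F \<le> card ?U \<and> d - card F < d \<and> card F \<le> d"
          if F: "F \<in> \<Delta>" "F \<subseteq> ?U" "F \<noteq> {}" for F
        proof -
          have EF: "euler_flag (d - card F) (lk \<Delta> F)" by (rule euler_flag_link[OF E F(1)])
          define l' where "l' = card (verts (lk \<Delta> F)) - 2 * (d - card F)"
          have l': "card (verts (lk \<Delta> F)) = 2 * (d - card F) + l'"
            using card_verts_ge[OF EF] by (simp add: l'_def)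
          obtain a where a: "a \<in> F" using F by auto
          then have "a \<in> verts \<Delta>" using F by (auto simp: simplicial_vertices_def)
          then have "card (verts (lk \<Delta> F)) + 2 * (card F - 1) \<le> card (verts (lk \<Delta> {v}))"
            using card_verts_link_vertex[OF E F(1) a] max order_trans by blast
          moreover have "card F \<ge> 1" using F cD(2) by (simp add: card_gt_0_iff Suc_le_eq)
          moreover have "card F \<le> d" using euler_flag_card_le[OF E F(1)] .
          moreover have "card F \<le> card ?U" using F fU by (intro card_mono)
          ultimately show ?thesis using l' card_v EF by (intro exI[of _ l']) auto
        qed
        have low: "gamma_vector (d - card F) (lk \<Delta> F) ((d - card F) div 2) = 0"
          if F: "F \<in> \<Delta>" "F \<subseteq> ?U" "F \<noteq> {}" "even (card F)" "card ?U \<noteq> 2" for F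
        proof -
          obtain l' where l': "euler_flag (d - card F) (lk \<Delta> F)" "card (verts (lk \<Delta> F)) = 2 * (d - card F) + l'"
            "l' + card ?U \<le> l + 1" "card F \<le> card ?U" "d - card F < d" "card F \<le> d"
            using face[OF F(1-3)] by blast
          have "card F \<noteq> 0" using F(3) cD(2)[OF F(1)] by simp
          then have "card F \<ge> 2" using F(4) by presburger
          \<comment> \<open>With at least three non-neighbours, \<open>l' + card F div 2\<close>
            stays below \<open>l\<close>, hence below \<open>d div 2\<close>; the degree
            \<open>(d - card F) div 2\<close> then exceeds the excess of the link.\<close>
          then have "card F div 2 + 1 < card ?U" using l'(4) U2[OF v] F(5) by linarith
          then have "l' + card F div 2 < d div 2" using l'(3) ld by linarith
          moreover obtain p q where pq: "d = 2 * p" "card F = 2 * q"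
            using d F(4) by (elim evenE)
          moreover have "(d - card F) div 2 = p - q"
            by (simp add: pq diff_mult_distrib2[symmetric])
          ultimately have "l' < (d - card F) div 2" by simp
          then show ?thesis using less.IH[OF l'(5,1,2)] by simp
        qed
        show ?thesis
        proof (cases "card ?U = 2 \<and> ?U \<in> \<Delta>")
          case False
          have "?\<gamma> (d div 2) = 0"
          proof (rule top_gamma_zero[OF E d v])
            fix F assume F: "F \<in> \<Delta>" "F \<subseteq> ?U" "F \<noteq> {}" "even (card F)"
            \<comment> \<open>A nonempty even face inside a two-element \<open>U\<close> would be
              \<open>U\<close> itself, which is not a face in this case.\<close>
            have "card ?U \<noteq> 2"
            proof
              assume c: "card ?U = 2"
              moreover have "card F \<le> 2" using c card_mono[OF fU F(2)] by simp
              moreover have "card F \<noteq> 0" using F cD(2) by simp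
              ultimately have "card F = 2" using F(4) by (metis One_nat_def le_Suc_eq le_zero_eq numeral_2_eq_2 odd_one)
              then have "F = ?U" using c F(2) fU card_subset_eq by metis
              then show False using False F(1) c by simp
            qed
            then show "gamma_vector (d - card F) (lk \<Delta> F) ((d - card F) div 2) = 0"
              using low F by simp
          qed
          then show ?thesis using finish by blast
        next
          case True
          then obtain a b where U: "?U = {a, b}" "a \<noteq> b" and ab: "{a, b} \<in> \<Delta>"
            by (auto simp: card_2_iff)
          have cab: "card {a, b} = 2" using U by simp
          let ?L = "lk \<Delta> {a, b}"
          obtain l' where l': "euler_flag (d - 2) ?L" "card (verts ?L) = 2 * (d - 2) + l'"
            "l' + 1 \<le> l" "d - 2 < d" "2 \<le> d"
            using face[OF ab] U cab by auto
          note IH = less.IH[OF l'(4,1,2)]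
          have top: "?\<gamma> (d div 2) = gamma_vector (d - 2) ?L ((d - 2) div 2)"
            by (rule top_gamma_edge[OF E d v U ab])
          show ?thesis
          proof (cases "l' < (d - 2) div 2")
            case True
            then have "?\<gamma> (d div 2) = 0" using top IH by simp
            then show ?thesis using finish by blast
          next
            case False
            \<comment> \<open>Equality throughout \<open>l' + 1 \<le> l \<le> d div 2\<close>: only
              an extremal link can produce a nonzero top coefficient.\<close>
            then have l'_eq: "l' = (d - 2) div 2" and l: "l = Suc l'" "d div 2 = l"
              using l'(3,5) ld by linarith+
            have d2: "d = 2 * l" using d l by auto
            have g: "?\<gamma> l = gamma_vector (d - 2) ?L l'" using top l l'_eq by simp
            have "\<exists>m. d = m + 2 * l \<and> simplicial_isomorphic \<Delta> (model m l)"
              if g1: "gamma_vector (d - 2) ?L l' = 1"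
            proof -
              obtain m where m: "d - 2 = m + 2 * l'" "simplicial_isomorphic ?L (model m l')"
                using IH g1 by auto
              \<comment> \<open>Here \<open>d - 2 = 2 * l'\<close>, so \<open>m = 0\<close>.\<close>
              then have iso: "simplicial_isomorphic ?L (join_power l' pentagon_complex)"
                using d2 l by simp
              \<comment> \<open>Four vertices come from the drop of \<open>d\<close> by
                \<open>2\<close>, the fifth from \<open>l = Suc l'\<close>.\<close>
              have "card (verts \<Delta>) = card (verts ?L) + 5"
                using less.prems(2) l' l by simp
              then obtain a' b' where p: "distinct [v, a', b, a, b']"
                "{v, a', b, a, b'} \<inter> verts ?L = {}" "\<Delta> = face_join (cycle5 v a' b a b') ?L"
                using pentagon_join[OF E v U ab] by auto
              have "simplicial_isomorphic (face_join (cycle5 v a' b a b') ?L)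
                (simplicial_join pentagon_complex (join_power l' pentagon_complex))"
              proof (rule simplicial_isomorphic_join[OF simplicial_isomorphic_cycle5[OF p(1)] iso])
                show "verts (cycle5 v a' b a b') \<inter> verts ?L = {}" using p(2) by (simp add: verts_cycle5)
                show "{} \<in> cycle5 v a' b a b'" by (simp add: cycle5_def)
                show "{} \<in> ?L" using ab cD(3) by (simp add: simplicial_link_def)
              qed
              then have "simplicial_isomorphic \<Delta> (simplicial_join pentagon_complex (join_power l' pentagon_complex))"
                by (subst p(3))
              then show ?thesis using l d2 by (intro exI[of _ 0]) simp
            qed
            then show ?thesis using g IH beyond l by auto
          qed
        qed
      qed
    qed
  qed
qed

section \<open>Gamma vectors of the models\<close>

lemma sum_encode_Plus:
  assumes "finite f" "finite g"
  shows "card (sum_encode ` (f <+> g)) = card f + card g"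
  using assms by (simp add: card_image card_Plus inj_sum_encode)

lemma inj_sum_encode_Plus:
  "sum_encode ` (f <+> g) = sum_encode ` (f' <+> g') \<longleftrightarrow> f = f' \<and> g = g'"
proof -
  have "sum_encode ` (f <+> g) = sum_encode ` (f' <+> g') \<longleftrightarrow> f <+> g = f' <+> g'"
    by (rule inj_image_eq_iff[OF inj_sum_encode])
  moreover have "Inl -` (f <+> g) = f" "Inr -` (f <+> g) = g" for f g :: "nat set"
    by auto
  ultimately show ?thesis by metis
qed

text \<open>The bound on face sizes keeps the truncated exponent \<open>d - card F\<close> additive
  under joins, so that h-polynomials of the models multiply without a proof that the models are
  spheres.\<close>

definition faces_le :: "nat \<Rightarrow> 'a set set \<Rightarrow> bool" where
  "faces_le d \<Delta> \<longleftrightarrow> finite \<Delta> \<and> {} \<in> \<Delta> \<and> (\<forall>f\<in>\<Delta>. finite f \<and> card f \<le> d)"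

lemma
  assumes X: "faces_le a X" and Y: "faces_le b Y"
  shows faces_le_join: "faces_le (a + b) (simplicial_join X Y)"
    and hpoly_join: "hpoly (a + b) (simplicial_join X Y) = hpoly a X * hpoly b Y"
    and card_verts_join: "card (verts (simplicial_join X Y)) = card (verts X) + card (verts Y)"
proof -
  have join: "simplicial_join X Y = (\<lambda>(f, g). sum_encode ` (f <+> g)) ` (X \<times> Y)"
    by (auto simp: simplicial_join_def)
  have inj: "inj_on (\<lambda>(f, g). sum_encode ` (f <+> g)) (X \<times> Y)"
    by (auto simp: inj_on_def inj_sum_encode_Plus)
  have card: "card (sum_encode ` (f <+> g)) = card f + card g" if "f \<in> X" "g \<in> Y" for f g
    using that X Y by (auto simp: faces_le_def sum_encode_Plus)
  show "faces_le (a + b) (simplicial_join X Y)"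
    unfolding faces_le_def
  proof (intro conjI ballI)
    show "finite (simplicial_join X Y)" using X Y by (simp add: join faces_le_def)
    have "{} = sum_encode ` ({} <+> {})" by simp
    then show "{} \<in> simplicial_join X Y"
      using X Y unfolding simplicial_join_def faces_le_def by blast
    fix h assume "h \<in> simplicial_join X Y"
    then obtain f g where h: "f \<in> X" "g \<in> Y" "h = sum_encode ` (f <+> g)"
      by (auto simp: simplicial_join_def)
    then show "finite h" using X Y by (auto simp: faces_le_def)
    show "card h \<le> a + b"
      using h card X Y by (auto simp: faces_le_def intro!: add_mono)
  qed
  have "hpoly (a + b) (simplicial_join X Y) = (\<Sum>(f, g)\<in>X \<times> Y. [:- 1, 1:] ^ (a + b - (card f + card g)))"
    unfolding hpoly_def join by (subst sum.reindex[OF inj]) (auto intro!: sum.cong simp: card)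
  also have "\<dots> = (\<Sum>(f, g)\<in>X \<times> Y. [:- 1, 1:] ^ (a - card f) * [:- 1, 1:] ^ (b - card g))"
  proof (rule sum.cong[OF refl], clarify)
    fix f g assume "f \<in> X" "g \<in> Y"
    then have "card f \<le> a" "card g \<le> b" using X Y by (auto simp: faces_le_def)
    then have "a + b - (card f + card g) = (a - card f) + (b - card g)" by simp
    then show "[:- 1, 1 :: int:] ^ (a + b - (card f + card g)) = [:- 1, 1:] ^ (a - card f) * [:- 1, 1:] ^ (b - card g)"
      by (simp only: power_add)
  qed
  also have "\<dots> = hpoly a X * hpoly b Y"
    by (simp add: hpoly_def sum_product sum.cartesian_product)
  finally show "hpoly (a + b) (simplicial_join X Y) = hpoly a X * hpoly b Y" .
  have "verts (simplicial_join X Y) = sum_encode ` (verts X <+> verts Y)"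
  proof (intro equalityI subsetI)
    fix x assume "x \<in> verts (simplicial_join X Y)"
    then obtain f g where "f \<in> X" "g \<in> Y" "x \<in> sum_encode ` (f <+> g)"
      by (auto simp: simplicial_vertices_def simplicial_join_def)
    then show "x \<in> sum_encode ` (verts X <+> verts Y)"
      by (auto simp: simplicial_vertices_def)
  next
    fix x assume "x \<in> sum_encode ` (verts X <+> verts Y)"
    then obtain f g where "f \<in> X" "g \<in> Y" "x \<in> sum_encode ` (f <+> g)"
      using X Y by (auto simp: simplicial_vertices_def faces_le_def)
    then show "x \<in> verts (simplicial_join X Y)"
      unfolding simplicial_vertices_def simplicial_join_def by blast
  qed
  moreover have "finite (verts X)" "finite (verts Y)"
    using X Y by (auto simp: simplicial_vertices_def faces_le_def)
  ultimately show "card (verts (simplicial_join X Y)) = card (verts X) + card (verts Y)"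
    by (simp add: sum_encode_Plus)
qed

lemma faces_le_models: "faces_le 1 sphere0_complex" "faces_le 2 pentagon_complex"
  by (auto simp: faces_le_def sphere0_complex_def pentagon_complex_def)

lemma hpoly_sphere0: "hpoly 1 sphere0_complex = [:1, 1:]"
  by (simp add: hpoly_def sphere0_complex_def one_pCons)

text \<open>In this form the gamma vector \<open>(1, 1)\<close> of the pentagon is visible.\<close>

lemma hpoly_pentagon: "hpoly 2 pentagon_complex = [:1, 1:] ^ 2 + [:0, 1:]"
proof -
  have "(\<Sum>F\<in>pentagon_complex. y ^ (2 - card F)) = (y + 2) ^ 2 + (y + 1)" for y :: "int poly"
    by (simp add: pentagon_complex_def doubleton_eq_iff power2_eq_square algebra_simps)
  \<comment> \<open>With one empty face, five vertices and five edges, the sum is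
    \<open>y^2 + 5 y + 5\<close>; \<open>y = z - 1\<close> turns the grouping above into
    \<open>(1 + z)^2 + z\<close>.\<close>
  moreover have "[:- 1, 1:] + 2 = [:1, 1 :: int:]" "[:- 1, 1:] + 1 = [:0, 1 :: int:]"
    by (simp_all add: numeral_poly one_pCons)
  ultimately show ?thesis unfolding hpoly_def by metis
qed

lemma card_verts_models: "card (verts sphere0_complex) = 2" "card (verts pentagon_complex) = 5"
proof -
  have "verts sphere0_complex = {0, 1}" "verts pentagon_complex = {0, 1, 2, 3, 4}"
    by (auto simp: simplicial_vertices_def sphere0_complex_def pentagon_complex_def)
  then show "card (verts sphere0_complex) = 2" "card (verts pentagon_complex) = 5" by simp_all
qed

lemma model_properties:
  "faces_le (m + 2 * l) (model m l) \<and>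
   hpoly (m + 2 * l) (model m l) = [:1, 1:] ^ m * ([:1, 1:] ^ 2 + [:0, 1:]) ^ l \<and>
   card (verts (model m l)) = 2 * m + 5 * l"
proof (induction m)
  case 0
  show ?case
  proof (induction l)
    case 0
    show ?case by (simp add: faces_le_def hpoly_def simplicial_vertices_def)
  next
    case (Suc l)
    let ?J = "join_power l pentagon_complex"
    have J: "faces_le (2 * l) ?J" using Suc by simp
    note * = faces_le_join[OF faces_le_models(2) J] hpoly_join[OF faces_le_models(2) J]
      card_verts_join[OF faces_le_models(2) J]
    show ?case
      using * Suc by (simp add: hpoly_pentagon card_verts_models)
  qed
next
  case (Suc m)
  have M: "faces_le (m + 2 * l) (model m l)" using Suc by simp
  note * = faces_le_join[OF faces_le_models(1) M] hpoly_join[OF faces_le_models(1) M]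
    card_verts_join[OF faces_le_models(1) M]
  have S: "model (Suc m) l = simplicial_join sphere0_complex (model m l)"
    by (simp add: simplicial_suspension_def)
  have d: "Suc m + 2 * l = 1 + (m + 2 * l)" by simp
  show ?case
    unfolding S d using Suc * by (simp only: hpoly_sphere0 card_verts_models power_Suc mult.assoc) simp
qed

text \<open>The binomial theorem for \<open>((1 + z)^2 + z)^l\<close>, whose terms are already in
  the gamma basis.\<close>

lemma gamma_expansion_model:
  "gamma_expansion (m + 2 * l) ([:1, 1:] ^ m * ([:1, 1:] ^ 2 + [:0, 1:]) ^ l) (\<lambda>i. int (l choose i))"
proof -
  let ?W = "[:1, 1 :: int:]" and ?Z = "[:0, 1 :: int:]"
  have "?W ^ m * (?W ^ 2 + ?Z) ^ l = ?W ^ m * (\<Sum>i\<le>l. of_nat (l choose i) * ?Z ^ i * (?W ^ 2) ^ (l - i))"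
    by (simp only: binomial_ring[of ?Z "?W ^ 2"] add.commute[of "?W ^ 2"])
  also have "\<dots> = (\<Sum>i\<le>l. of_int (int (l choose i)) * ?Z ^ i * ?W ^ (m + 2 * l - 2 * i))"
    unfolding sum_distrib_left
  proof (rule sum.cong[OF refl])
    fix i assume "i \<in> {..l}"
    then have "m + 2 * l - 2 * i = m + 2 * (l - i)" by auto
    then show "?W ^ m * (of_nat (l choose i) * ?Z ^ i * (?W ^ 2) ^ (l - i)) =
        of_int (int (l choose i)) * ?Z ^ i * ?W ^ (m + 2 * l - 2 * i)"
      by (simp only: power_add power_mult of_int_of_nat_eq) (simp only: mult_ac)
  qed
  also have "\<dots> = (\<Sum>i\<le>(m + 2 * l) div 2. of_int (int (l choose i)) * ?Z ^ i * ?W ^ (m + 2 * l - 2 * i))"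
    by (rule sum.mono_neutral_left) auto
  finally show ?thesis
    by (auto simp: gamma_expansion_def)
qed

lemma isomorphic_faces:
  assumes "simplicial_isomorphic \<Delta> \<Gamma>"
  shows "hpoly d \<Delta> = hpoly d \<Gamma>" "card (verts \<Delta>) = card (verts \<Gamma>)"
proof -
  obtain \<phi> where \<phi>: "bij_betw \<phi> (verts \<Delta>) (verts \<Gamma>)" "(\<lambda>f. \<phi> ` f) ` \<Delta> = \<Gamma>"
    using assms by (auto simp: simplicial_isomorphic_def)
  show "card (verts \<Delta>) = card (verts \<Gamma>)" using bij_betw_same_card[OF \<phi>(1)] .
  have sub: "f \<subseteq> verts \<Delta>" if "f \<in> \<Delta>" for f using that by (auto simp: simplicial_vertices_def)
  have inj: "inj_on \<phi> (verts \<Delta>)" using \<phi>(1) by (simp add: bij_betw_def)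
  have "inj_on (\<lambda>f. \<phi> ` f) \<Delta>"
    using sub inj_on_image_eq_iff[OF inj] by (auto simp: inj_on_def)
  then have "hpoly d \<Gamma> = (\<Sum>f\<in>\<Delta>. [:- 1, 1:] ^ (d - card (\<phi> ` f)))"
    unfolding hpoly_def \<phi>(2)[symmetric] by (subst sum.reindex) auto
  also have "\<dots> = hpoly d \<Delta>"
    unfolding hpoly_def
  proof (rule sum.cong[OF refl])
    fix f assume "f \<in> \<Delta>"
    then have "card (\<phi> ` f) = card f"
      using card_image inj_on_subset[OF inj] sub by blast
    then show "[:- 1, 1:] ^ (d - card (\<phi> ` f)) = [:- 1, 1 :: int:] ^ (d - card f)" by simp
  qed
  finally show "hpoly d \<Delta> = hpoly d \<Gamma>" by simp
qed

text \<open>The vertex counts \<open>2 * d + l = 2 * m + 5 * l\<close> determine \<open>d\<close>;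
  the expansion of the model is then the gamma vector, with entry \<open>l choose l\<close> in
  degree \<open>l\<close>.\<close>

lemma gamma_vector_model:
  assumes E: "euler_flag d \<Delta>" and card: "card (verts \<Delta>) = 2 * d + l"
    and iso: "simplicial_isomorphic \<Delta> (model m l)"
  shows "gamma_vector d \<Delta> l = 1"
proof -
  have "2 * d + l = 2 * m + 5 * l"
    using isomorphic_faces(2)[OF iso] card model_properties[of m l] by simp
  then have d: "d = m + 2 * l" by simp
  have "gamma_expansion d (hpoly d \<Delta>) (\<lambda>i. int (l choose i))"
    using gamma_expansion_model[of m l] isomorphic_faces(1)[OF iso, of d] model_properties[of m l]
    by (simp add: d)
  then have "gamma_vector d \<Delta> = (\<lambda>i. int (l choose i))"
    using gamma_vector_expansion[OF E] gamma_expansion_unique by blast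
  then show ?thesis by simp
qed

theorem theorem4p2:
  fixes \<Delta> :: "'a set set" and d l :: nat
  assumes "d \<ge> 2"
    and "homology_sphere TYPE('k::field) d \<Delta>"
    and "flag_complex \<Delta>"
    and "card (simplicial_vertices \<Delta>) = 2 * d + l"
  shows "0 \<le> gamma_vector d \<Delta> l \<and> gamma_vector d \<Delta> l \<le> 1 \<and>
         (\<forall>j>l. gamma_vector d \<Delta> j = 0) \<and>
         (gamma_vector d \<Delta> l = 1 \<longleftrightarrow>
            (\<exists>m. simplicial_isomorphic \<Delta>
                   ((simplicial_suspension ^^ m) (join_power l pentagon_complex))))"
proof -
  have E: "euler_flag d \<Delta>"
    using homology_sphere_euler_flag assms(2,3) by blast
  show ?thesis
    using gamma_vector_few_vertices[OF E assms(4)] gamma_vector_model[OF E assms(4)] by blast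
qed

end
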